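(* Let $(X,d,\mu)$ be a coarse median space and $n\in\mathbb N\setminus\{0\}$. Then the following are equivalent: 1) $\operatorname{rank}X\le n$; 2) (Multi-median condition) There exists a non-decreasing function $\psi:\mathbb R^+\to\mathbb R^+$ such that for any $\lambda>0$ and any $x_1,\ldots,x_{n+1},q\in X$, $$\bigcap_{i\neq j}\mathcal N_\lambda([x_i,x_j])\subseteq\bigcup_{i=1}^{n+1}\mathcal N_{\psi(\lambda)}([x_i,q]);$$ 3) (Thin $(n+1)$-cubes condition) There exists a non-decreasing function $\varphi:\mathbb R^+\to\mathbb R^+$ such that $$\min\{d(p,\mu(x_i,p,q)):i=1,\ldots,n+1\}\le\varphi\big(\max\{d(p,\mu(x_i,x_j,p)):i\neq j\}\big)$$ for any $x_1,\ldots,x_{n+1}$ and $p,q\in X$.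
   Context: Here $\mathbb R^+=[0,\infty)$; indices $i,j$ range over $\{1,\ldots,n+1\}$. Coarse median space: a triple $(X,d,\mu)$ with $(X,d)$ a metric space and $\mu:X^3\to X$ satisfying: (M1) $\mu(a,a,b)=a$; (M2) $\mu$ is invariant under all permutations of its three arguments; (C1) there is an affine function $\rho:[0,\infty)\to[0,\infty)$ with $d(\mu(a,b,c),\mu(a',b,c))\le\rho(d(a,a'))$; (C2) there is a constant $\kappa_4>0$ with $d(\mu(\mu(a,b,c),b,d),\mu(a,b,\mu(c,b,d)))\le\kappa_4$ for all $a,b,c,d\in X$. It is known (equivalence with Bowditch's original definition) that such a space satisfies: (B2) there is $h:\mathbb N\to\mathbb R^+$ such that for every $A\subseteq X$ with $1\le|A|\le p<\infty$ there are a finite median algebra $(\Pi,\mu_\Pi)$ and maps $\pi:A\to\Pi$, $\lambda:\Pi\to X$ with $d(\lambda(\mu_\Pi(x,y,z)),\mu(\lambda(x),\lambda(y),\lambda(z)))\le h(p)$ for all $x,y,z\in\Pi$ and $d(a,\lambda\pi(a))\le h(p)$ for all $a\in A$. A median algebra is a set with a ternary operation satisfying (M1), (M2) and $\mu(a,b,\mu(c,d,e))=\mu(\mu(a,b,c),\mu(a,b,d),e)$. The median $m$-cube $I^m$ is $\{0,1\}^m$ with coordinatewise majority vote; the rank of a median algebra is the supremum of the $m$ for which it contains a median subalgebra isomorphic to $I^m$. Rank: $\operatorname{rank}X\le n$ means that (B2) can be satisfied (for some $h$) with all the median algebras $\Pi$ of rank at most $n$. It is a known theorem (Niblo–Wright–Zhang)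 that $\operatorname{rank}X\le n$ is equivalent to: for every $\lambda>0$ there is $C=C(\lambda)$ such that for any $a,b\in X$ and $e_1,\ldots,e_{n+1}\in[a,b]$ with $d(\mu(e_i,a,e_j),a)\le\lambda$ for all $i\ne j$, some $e_i$ satisfies $d(e_i,a)\le C$. Intervals: $[a,b]=\{\mu(a,x,b)\mid x\in X\}$. Neighbourhoods: $\mathcal N_R(A)=\{x\in X:\exists a\in A,\ d(x,a)\le R\}$. *)

theory Defs
  imports "HOL-Analysis.Analysis" "HOL-Library.Extended_Nat" "HOL-Library.FuncSet"
begin

type_synonym 'a ternary = "'a \<Rightarrow> 'a \<Rightarrow> 'a \<Rightarrow> 'a"

definition fully_symmetric_on :: "'a set \<Rightarrow> 'a ternary \<Rightarrow> bool" where
  "fully_symmetric_on A \<mu> \<longleftrightarrow> (\<forall>a\<in>A. \<forall>b\<in>A. \<forall>c\<in>A.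
     \<mu> a c b = \<mu> a b c \<and> \<mu> b a c = \<mu> a b c \<and> \<mu> b c a = \<mu> a b c \<and>
     \<mu> c a b = \<mu> a b c \<and> \<mu> c b a = \<mu> a b c)"

locale median_algebra =
  fixes A :: "'a set" and \<mu> :: "'a ternary"
  assumes closed: "\<lbrakk>a \<in> A; b \<in> A; c \<in> A\<rbrakk> \<Longrightarrow> \<mu> a b c \<in> A"
    and M1: "\<lbrakk>a \<in> A; b \<in> A\<rbrakk> \<Longrightarrow> \<mu> a a b = a"
    and M2: "fully_symmetric_on A \<mu>"
    and M3: "\<lbrakk>a \<in> A; b \<in> A; c \<in> A; d \<in> A; e \<in> A\<rbrakk> \<Longrightarrow>
               \<mu> a b (\<mu> c d e) = \<mu> (\<mu> a b c) (\<mu> a b d) e"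

definition median_subalgebra :: "'a set \<Rightarrow> 'a set \<Rightarrow> 'a ternary \<Rightarrow> bool" where
  "median_subalgebra S A \<mu> \<longleftrightarrow>
     S \<subseteq> A \<and> (\<forall>x\<in>S. \<forall>y\<in>S. \<forall>z\<in>S. \<mu> x y z \<in> S)"

definition median_isomorphic :: "'a set \<Rightarrow> 'a ternary \<Rightarrow> 'b set \<Rightarrow> 'b ternary \<Rightarrow> bool" where
  "median_isomorphic A \<mu> B \<nu> \<longleftrightarrow>
     (\<exists>f. bij_betw f A B \<and>
        (\<forall>x\<in>A. \<forall>y\<in>A. \<forall>z\<in>A. f (\<mu> x y z) = \<nu> (f x) (f y) (f z)))"

text \<open>The median cube, with \<^const>\<open>False\<close> and \<^const>\<open>True\<close> for the coordinates 0 and 1.\<close>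

definition cube :: "nat \<Rightarrow> (nat \<Rightarrow> bool) set" where
  "cube m = {..<m} \<rightarrow>\<^sub>E UNIV"

definition cube_median :: "nat \<Rightarrow> (nat \<Rightarrow> bool) ternary" where
  "cube_median m x y z =
     (\<lambda>i\<in>{..<m}. (x i \<and> y i) \<or> (y i \<and> z i) \<or> (x i \<and> z i))"

definition median_rank :: "'a set \<Rightarrow> 'a ternary \<Rightarrow> enat" where
  "median_rank A \<mu> = Sup {enat m | m. \<exists>S. median_subalgebra S A \<mu> \<and>
     median_isomorphic (cube m) (cube_median m) S \<mu>}"

text \<open>The space \<open>X\<close> is the whole type, and its metric is \<^const>\<open>dist\<close>.\<close>

locale coarse_median_space =
  fixes \<mu> :: "'a::metric_space ternary"
  assumes M1: "\<mu> a a b = a"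
    and M2: "fully_symmetric_on UNIV \<mu>"
    and C1: "\<exists>\<rho>::real \<Rightarrow> real.
               (\<exists>K c. \<forall>t\<ge>0. \<rho> t = K * t + c) \<and> (\<forall>t\<ge>0. \<rho> t \<ge> 0) \<and>
               (\<forall>a a' b c. dist (\<mu> a b c) (\<mu> a' b c) \<le> \<rho> (dist a a'))"
    and C2: "\<exists>\<kappa>>0. \<forall>a b c d. dist (\<mu> (\<mu> a b c) b d) (\<mu> a b (\<mu> c b d)) \<le> \<kappa>"

text \<open>
  Every finite median algebra is isomorphic to one whose carrier is a finite set of natural
  numbers, so taking the carriers of the approximating algebras in \<^typ>\<open>nat\<close> loses nothing.
\<close>

definition coarse_median_rank_le :: "'a::metric_space ternary \<Rightarrow> nat \<Rightarrow> bool" where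
  "coarse_median_rank_le \<mu> n \<longleftrightarrow>
     (\<exists>h :: nat \<Rightarrow> real. (\<forall>p. h p \<ge> 0) \<and>
       (\<forall>p A. finite A \<and> 1 \<le> card A \<and> card A \<le> p \<longrightarrow>
         (\<exists>(P :: nat set) \<nu> (\<pi> :: 'a \<Rightarrow> nat) (l :: nat \<Rightarrow> 'a).
            finite P \<and> median_algebra P \<nu> \<and> median_rank P \<nu> \<le> enat n \<and>
            \<pi> ` A \<subseteq> P \<and>
            (\<forall>x\<in>P. \<forall>y\<in>P. \<forall>z\<in>P. dist (l (\<nu> x y z)) (\<mu> (l x) (l y) (l z)) \<le> h p) \<and>
            (\<forall>a\<in>A. dist a (l (\<pi> a)) \<le> h p))))"

definition interval :: "'a ternary \<Rightarrow> 'a \<Rightarrow> 'a \<Rightarrow> 'a set" where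
  "interval \<mu> a b = {\<mu> a x b | x. True}"

definition nbhd :: "real \<Rightarrow> 'a::metric_space set \<Rightarrow> 'a set" where
  "nbhd R A = {x. \<exists>a\<in>A. dist x a \<le> R}"

definition nondecreasing_nonneg :: "(real \<Rightarrow> real) \<Rightarrow> bool" where
  "nondecreasing_nonneg f \<longleftrightarrow> f ` {0..} \<subseteq> {0..} \<and> mono_on {0..} f"

text \<open>
  Tuples of \<open>n + 1\<close> points are functions on \<^typ>\<open>nat\<close> of which only the values on
  \<open>{1..n + 1}\<close> are used.
\<close>

definition distinct_pairs :: "nat \<Rightarrow> (nat \<times> nat) set" where
  "distinct_pairs n = {(i, j). i \<in> {1..n + 1} \<and> j \<in> {1..n + 1} \<and> i \<noteq> j}"

definition multi_median_condition :: "'a::metric_space ternary \<Rightarrow> nat \<Rightarrow> bool" where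
  "multi_median_condition \<mu> n \<longleftrightarrow>
     (\<exists>\<psi>. nondecreasing_nonneg \<psi> \<and>
       (\<forall>r>0. \<forall>(x :: nat \<Rightarrow> 'a) q.
          (\<Inter>(i, j)\<in>distinct_pairs n. nbhd r (interval \<mu> (x i) (x j)))
            \<subseteq> (\<Union>i\<in>{1..n + 1}. nbhd (\<psi> r) (interval \<mu> (x i) q))))"

definition thin_cubes_condition :: "'a::metric_space ternary \<Rightarrow> nat \<Rightarrow> bool" where
  "thin_cubes_condition \<mu> n \<longleftrightarrow>
     (\<exists>\<phi>. nondecreasing_nonneg \<phi> \<and>
       (\<forall>(x :: nat \<Rightarrow> 'a) p q.
          Min ((\<lambda>i. dist p (\<mu> (x i) p q)) ` {1..n + 1})
            \<le> \<phi> (Max ((\<lambda>(i, j). dist p (\<mu> (x i) (x j) p)) ` distinct_pairs n))))"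

end

theory Submission
  imports Defs
begin

text \<open>
  The heart of the matter is the equivalence of rank at most \<open>n\<close> with thinness of
  \<open>(n + 1)\<close>-cubes in the form: a bound \<open>R\<close> on the distances from \<open>p\<close> to all medians of \<open>x i\<close>, \<open>x j\<close>,
  \<open>p\<close> forces a bound \<open>C\<close> on the distance from \<open>p\<close> to the median of \<open>x i\<close>, \<open>p\<close>, \<open>q\<close>, for some \<open>i\<close>.
  The multi-median condition says the same with distances to intervals, because a point is close to
  an interval iff it is close to its projection to that interval.

  Two facts about exact median algebras are used, both consequences of the separation of points by
  homomorphisms to the two-point algebra (\<open>separation\<close>): finitely generated median algebras are finite
  (\<open>finitely_generated_finite\<close>), and an identity holds as soon as it holds for truth values.
  Separation is derived from the four-point identity, the exact form of the axiom (C2), because this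
  is the identity that the quotients below inherit from the space; their five-point identity then
  follows by a check on truth values.

  Bounded rank implies thinness.  Approximate the points \<open>x i\<close>, \<open>p\<close>, \<open>q\<close> by a median algebra of rank
  at most \<open>n\<close>.  In the distributive lattice between \<open>p\<close> and \<open>q\<close> let \<open>y i\<close> be the projection of \<open>x i\<close>
  and \<open>s\<close> the join of the pairwise meets of the \<open>y i\<close>.  Above \<open>s\<close>, the joins of \<open>s\<close> with the \<open>y i\<close>
  are pairwise disjoint, so if none of them were \<open>s\<close> they would span an \<open>(n + 1)\<close>-cube.  Hence
  some \<open>y i\<close> is below \<open>s\<close> (\<open>rank_le_imp_below_join\<close>).  The pairwise meets are close to \<open>p\<close> in the
  space, so \<open>s\<close> is, and therefore \<open>y i\<close> is (\<open>rank_le_imp_thin\<close>).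

  Thinness implies bounded rank.  Median expressions in finitely many variables are functions of a tuple
  of points.  Identify two of them if they stay at bounded distance on a set \<open>K\<close> of tuples.  The
  coarse axioms become exact, and the quotient is a finitely generated, hence finite, median
  algebra.  If it has rank at most \<open>n\<close>, evaluating its elements at a tuple in \<open>K\<close> approximates that
  tuple, with an error uniform on \<open>K\<close>.  Otherwise it contains a cube of dimension above \<open>n\<close>, and
  thinness says that for each tuple in \<open>K\<close> the corner of the cube is close to one of \<open>n + 1\<close>
  neighbours.  This divides \<open>K\<close> into finitely many parts on each of which two elements of the
  quotient are identified, and induction on the size of the quotient finishes the argument
  (\<open>thin_imp_approximated\<close>), starting from the set of all tuples.
\<close>

section \<open>Median algebras from the four-point identity\<close>

locale associative_median =
  fixes A :: "'a set" and \<mu> :: "'a ternary"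
  assumes closed: "\<lbrakk>a \<in> A; b \<in> A; c \<in> A\<rbrakk> \<Longrightarrow> \<mu> a b c \<in> A"
    and idem: "\<lbrakk>a \<in> A; b \<in> A\<rbrakk> \<Longrightarrow> \<mu> a a b = a"
    and symm: "fully_symmetric_on A \<mu>"
    and assoc: "\<lbrakk>a \<in> A; b \<in> A; c \<in> A; d \<in> A\<rbrakk> \<Longrightarrow>
                  \<mu> (\<mu> a b c) b d = \<mu> a b (\<mu> c b d)"
begin

definition btw :: "'a \<Rightarrow> 'a \<Rightarrow> 'a \<Rightarrow> bool" where
  "btw a x b \<longleftrightarrow> a \<in> A \<and> x \<in> A \<and> b \<in> A \<and> \<mu> a x b = x"

lemma btwD: "btw a x b \<Longrightarrow> a \<in> A" "btw a x b \<Longrightarrow> x \<in> A" "btw a x b \<Longrightarrow> b \<in> A"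
  by (auto simp: btw_def)

lemma perm:
  assumes "a \<in> A" "b \<in> A" "c \<in> A"
  shows "\<mu> a c b = \<mu> a b c" "\<mu> b a c = \<mu> a b c" "\<mu> b c a = \<mu> a b c"
    "\<mu> c a b = \<mu> a b c" "\<mu> c b a = \<mu> a b c"
  using symm assms unfolding fully_symmetric_on_def by auto

lemma btw_commute: "btw a x b \<Longrightarrow> btw b x a"
  unfolding btw_def using perm by metis

lemma btw_left: "a \<in> A \<Longrightarrow> b \<in> A \<Longrightarrow> btw a a b"
  unfolding btw_def using idem by auto

lemma btw_right: "a \<in> A \<Longrightarrow> b \<in> A \<Longrightarrow> btw a b b"
  using btw_left btw_commute by blast

lemma btw_same: "btw a x a \<Longrightarrow> x = a"
  unfolding btw_def using idem perm by metis

text \<open>Each base point \<open>b\<close> makes \<open>\<lambda>x y. \<mu> x b y\<close> a semilattice operation with least element \<open>b\<close>,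
  whose order is betweenness seen from \<open>b\<close>.  The next lemmas read this off.\<close>

lemma btw_median:
  assumes "a \<in> A" "b \<in> A" "c \<in> A"
  shows "btw a (\<mu> a b c) b" "btw a (\<mu> a b c) c" "btw b (\<mu> a b c) c"
proof -
  have *: "btw a (\<mu> a b c) b" if "a \<in> A" "b \<in> A" "c \<in> A" for a b c
  proof -
    have "\<mu> a (\<mu> a b c) b = \<mu> (\<mu> c a b) a b"
      using that perm[OF that] perm[OF \<open>a \<in> A\<close> \<open>b \<in> A\<close> closed[OF that]] by simp
    also have "\<dots> = \<mu> c a (\<mu> b a b)" using that by (intro assoc)
    also have "\<mu> b a b = b" using that idem perm by metis
    finally show ?thesis using that perm[OF that] by (auto simp: btw_def closed)
  qed
  show "btw a (\<mu> a b c) b" "btw a (\<mu> a b c) c" "btw b (\<mu> a b c) c"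
    using *[of a b c] *[of a c b] *[of b c a] assms perm[OF assms] by auto
qed

lemma btw_trans:
  assumes "btw a x b" "btw a y x"
  shows "btw a y b"
proof -
  have A: "a \<in> A" "x \<in> A" "b \<in> A" "y \<in> A" using assms btwD by auto
  have "\<mu> y a b = \<mu> (\<mu> y a x) a b" using assms A unfolding btw_def by (metis perm)
  also have "\<dots> = \<mu> y a (\<mu> x a b)" using A by (intro assoc)
  also have "\<dots> = y" using assms A unfolding btw_def by (metis perm)
  finally show ?thesis using A unfolding btw_def by (metis perm)
qed

lemma btw_trans2:
  assumes "btw a x b" "btw a y x"
  shows "btw y x b"
proof -
  have A: "a \<in> A" "x \<in> A" "b \<in> A" "y \<in> A" using assms btwD by auto
  have "\<mu> y x b = \<mu> (\<mu> y x a) x b" using assms A unfolding btw_def by (metis perm)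
  also have "\<dots> = \<mu> y x (\<mu> a x b)" using A by (intro assoc)
  also have "\<dots> = x" using assms A unfolding btw_def by (metis perm idem)
  finally show ?thesis using A unfolding btw_def by (metis perm)
qed

lemma btw_antisym: "btw a x y \<Longrightarrow> btw a y x \<Longrightarrow> x = y"
  unfolding btw_def using perm by metis

lemma btw_greatest:
  assumes "btw a m b" "btw a m c"
  shows "btw a m (\<mu> a b c)"
proof -
  have A: "a \<in> A" "m \<in> A" "b \<in> A" "c \<in> A" using assms btwD by auto
  have "\<mu> m a (\<mu> b a c) = \<mu> (\<mu> m a b) a c" using A by (intro assoc[symmetric])
  also have "\<dots> = m" using assms A unfolding btw_def by (metis perm)
  finally show ?thesis using A closed[of b a c] unfolding btw_def by (metis perm)
qed

lemma median_unique:
  assumes "btw a m b" "btw a m c" "btw b m c"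
  shows "m = \<mu> a b c"
proof -
  have A: "a \<in> A" "m \<in> A" "b \<in> A" "c \<in> A" using assms btwD by auto
  have "btw a m (\<mu> a b c)" using assms by (intro btw_greatest)
  moreover have "btw a (\<mu> a b c) b" using A by (intro btw_median)
  ultimately have 1: "btw m (\<mu> a b c) b" using btw_trans2 by blast
  have "btw b m (\<mu> b a c)" using assms btw_commute by (intro btw_greatest) auto
  then have "btw b m (\<mu> a b c)" using A perm by metis
  then show ?thesis using 1 btw_antisym btw_commute by blast
qed

text \<open>The special case of the convexity of intervals in which one end of the inner interval is the
  projection of \<open>v\<close>.  The projections \<open>s\<close>, \<open>t\<close> of \<open>a\<close>, \<open>b\<close> to the interval from \<open>v\<close> to \<open>m\<close> lie in
  this order on the way from \<open>a\<close> through \<open>m\<close> to \<open>b\<close>, and \<open>v\<close> is between them.  So \<open>v\<close> is between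
  \<open>a\<close> and \<open>b\<close>, and equals its projection.\<close>

lemma interval_convex_aux:
  assumes m: "btw a m b" and u: "u = \<mu> a b v" and v: "btw u v m"
  shows "v = u"
proof -
  have A: "a \<in> A" "m \<in> A" "b \<in> A" "u \<in> A" "v \<in> A" using assms btwD by auto
  define s where "s = \<mu> v a m"
  define t where "t = \<mu> v b m"
  have sA: "s \<in> A" and tA: "t \<in> A" using A by (auto simp: s_def t_def closed)
  have s: "btw a s m" "btw v s a" "btw v s m" using A btw_median by (auto simp: s_def)
  have t: "btw b t m" "btw v t b" "btw v t m" using A btw_median by (auto simp: t_def)
  have st: "btw s m b" using m s(1) by (rule btw_trans2)
  have sab: "btw a s b" using m s(1) by (rule btw_trans)
  have tab: "btw a t b" using btw_trans[OF btw_commute[OF m] t(1)] by (rule btw_commute)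
  have tsb: "btw s t b" using btw_trans[OF btw_commute[OF st] t(1)] by (rule btw_commute)
  have ast: "btw a s t"
    using btw_trans2[OF btw_commute[OF sab] btw_commute[OF tsb]] by (rule btw_commute)
  have mub: "\<mu> u v m = v" using v by (simp add: btw_def)
  have "\<mu> s v t = \<mu> (\<mu> a v m) v (\<mu> m v b)" using A unfolding s_def t_def by (metis perm)
  also have "\<dots> = \<mu> a v (\<mu> m v (\<mu> m v b))" using A by (simp add: assoc closed)
  also have "\<mu> m v (\<mu> m v b) = \<mu> b v m" using A assoc[of m v m b] idem perm by metis
  also have "\<mu> a v (\<mu> b v m) = \<mu> (\<mu> a v b) v m" using A assoc by metis
  also have "\<mu> a v b = u" using A u perm by metis
  finally have "\<mu> s v t = v" using mub by simp
  then have "btw s v t" using A sA tA by (simp add: btw_def)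
  then have "btw a v t" using btw_trans[OF btw_commute[OF ast]] btw_commute by blast
  then have "btw a v b" using tab btw_trans by blast
  then show ?thesis using u A unfolding btw_def by (metis perm)
qed

text \<open>Let \<open>u\<close> be the projection of \<open>w\<close> to the interval from \<open>a\<close> to \<open>b\<close>.  Since the median \<open>v\<close> of \<open>m\<close>,
  \<open>u\<close>, \<open>w\<close> has the same projection \<open>u\<close>, the special case gives \<open>v = u\<close>.  So \<open>u\<close> is between \<open>w\<close> and
  \<open>m\<close>, and likewise between \<open>w\<close> and \<open>z\<close>; as \<open>w\<close> is between \<open>m\<close> and \<open>z\<close>, this forces \<open>u = w\<close>.\<close>

lemma interval_convex:
  assumes m: "btw a m b" and z: "btw a z b" and w: "btw m w z"
  shows "btw a w b"
proof -
  have A: "a \<in> A" "b \<in> A" "m \<in> A" "z \<in> A" "w \<in> A" using assms btwD by auto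
  define u where "u = \<mu> a b w"
  have uA: "u \<in> A" using A by (simp add: u_def closed)
  have u: "btw w u a" "btw w u b" "btw a u b"
    using A btw_median[of a b w] btw_commute by (auto simp: u_def)
  have key: "btw m u w" if m: "btw a m b" for m
  proof -
    have mA: "m \<in> A" using m btwD by auto
    define v where "v = \<mu> m u w"
    have v: "btw u v m" "btw u v w" using btw_median[OF mA uA A(5)] btw_commute by (auto simp: v_def)
    have "btw v u a" using u(1) btw_commute[OF v(2)] btw_trans2[of w u a v] v(2) by blast
    moreover have "btw v u b" using u(2) btw_commute[OF v(2)] btw_trans2[of w u b v] by blast
    ultimately have "u = \<mu> a b v" using median_unique u(3) btw_commute by blast
    then have "v = u" using m v(1) interval_convex_aux by blast
    then show ?thesis using btw_median[OF mA uA A(5)] mA uA A unfolding v_def btw_def by metis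
  qed
  have 1: "btw m u w" and 2: "btw z u w" using key m z by auto
  have "btw u w z" using w 1 by (rule btw_trans2)
  then have "u = w" using 2 btw_antisym btw_commute by blast
  then show ?thesis using u(3) by simp
qed

text \<open>By convexity the median \<open>w\<close> of \<open>x\<close>, its projection \<open>m\<close> and \<open>z\<close> is in the interval from \<open>a\<close> to
  \<open>b\<close>.  It is also between \<open>m\<close> and \<open>x\<close>, so it is a median of \<open>a\<close>, \<open>b\<close>, \<open>x\<close> and must be \<open>m\<close>.\<close>

lemma btw_gate:
  assumes z: "btw a z b" and x: "x \<in> A"
  shows "btw x (\<mu> a b x) z"
proof -
  have A: "a \<in> A" "b \<in> A" "z \<in> A" "x \<in> A" using assms btwD by auto
  define m where "m = \<mu> a b x"
  define w where "w = \<mu> x m z"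
  have mA: "m \<in> A" using A by (simp add: m_def closed)
  have m: "btw a m b" "btw a m x" "btw b m x" using A btw_median by (auto simp: m_def)
  have w: "btw x w m" "btw m w z" "btw x w z" using A mA btw_median by (auto simp: w_def)
  have "btw a w b" using m(1) z w(2) by (rule interval_convex)
  moreover have "btw a w x" using btw_trans[OF btw_commute[OF m(2)] w(1)] btw_commute by blast
  moreover have "btw b w x" using btw_trans[OF btw_commute[OF m(3)] w(1)] btw_commute by blast
  ultimately have "w = m" unfolding m_def by (rule median_unique)
  then show ?thesis using w(3) by (simp add: m_def)
qed

text \<open>The points \<open>x\<close> with \<open>btw e b x\<close> form the shadow of \<open>b\<close> seen from \<open>e\<close>.  Let \<open>f\<close> be the median of
  \<open>e\<close>, \<open>b\<close>, \<open>z\<close>.  Seen from \<open>f\<close>, the gate of the interval from \<open>x\<close> to \<open>y\<close> is in the shadow of \<open>b\<close>,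
  and \<open>z\<close> is in the shadow of the gate; but \<open>f\<close> is between \<open>b\<close> and \<open>z\<close>, so \<open>f = b\<close>.\<close>

lemma shadow_convex:
  assumes x: "btw e b x" and y: "btw e b y" and z: "btw x z y"
  shows "btw e b z"
proof -
  have A: "e \<in> A" "b \<in> A" "x \<in> A" "y \<in> A" "z \<in> A" using assms btwD by auto
  define f where "f = \<mu> e b z"
  have f: "btw e f b" "btw b f z" "btw e f z" using A btw_median by (auto simp: f_def)
  have fA: "f \<in> A" using f btwD by auto
  have "btw f b x" "btw f b y" using f(1) x y btw_trans2 by auto
  then have "btw f b (\<mu> f x y)" by (rule btw_greatest)
  moreover have "btw f (\<mu> f x y) z" using btw_gate[OF z fA] A fA perm by metis
  ultimately have "btw f b z" using btw_trans by blast
  then have "b = f" using f(2) btw_antisym btw_commute by blast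
  then show ?thesis using f(3) by simp
qed

definition convex_in :: "'a set \<Rightarrow> bool" where
  "convex_in C \<longleftrightarrow> C \<subseteq> A \<and> (\<forall>x\<in>C. \<forall>y\<in>C. \<forall>z. btw x z y \<longrightarrow> z \<in> C)"

lemma convex_in_subset: "convex_in C \<Longrightarrow> C \<subseteq> A"
  by (simp add: convex_in_def)

lemma convex_inD: "convex_in C \<Longrightarrow> x \<in> C \<Longrightarrow> y \<in> C \<Longrightarrow> btw x z y \<Longrightarrow> z \<in> C"
  unfolding convex_in_def by blast

lemma join_convex:
  assumes C: "convex_in C" and x: "x \<in> A"
  shows "convex_in {u. \<exists>c\<in>C. btw c u x}"
  unfolding convex_in_def
proof (intro conjI ballI allI impI)
  show "{u. \<exists>c\<in>C. btw c u x} \<subseteq> A" using btwD by auto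
next
  fix u v w
  assume "u \<in> {u. \<exists>c\<in>C. btw c u x}" "v \<in> {u. \<exists>c\<in>C. btw c u x}" and w: "btw u w v"
  then obtain c c' where c: "c \<in> C" "btw c u x" "c' \<in> C" "btw c' v x" by auto
  have A: "c \<in> A" "c' \<in> A" "w \<in> A" using c w btwD by auto
  define d where "d = \<mu> c c' w"
  have d: "btw c d c'" "btw c d w" "btw c' d w" using A btw_median by (auto simp: d_def)
  have dC: "d \<in> C" using convex_inD[OF C c(1,3) d(1)] .
  have dA: "d \<in> A" using d btwD by auto
  \<comment> \<open>\<open>w'\<close> is the gate of \<open>w\<close> in the interval from \<open>d\<close> to \<open>x\<close>; the shadow of \<open>w'\<close> seen from \<open>w\<close>
     contains \<open>c\<close>, \<open>c'\<close> and \<open>x\<close>, hence \<open>u\<close>, \<open>v\<close> and \<open>w\<close>.\<close>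
  define w' where "w' = \<mu> w x d"
  have w': "btw w w' x" "btw w w' d" using A x dA btw_median by (auto simp: w'_def)
  have "btw w w' c" "btw w w' c'"
    using btw_trans[OF btw_commute[OF d(2)] w'(2)] btw_trans[OF btw_commute[OF d(3)] w'(2)] by auto
  then have "btw w w' u" "btw w w' v" using shadow_convex w'(1) c by blast+
  then have "btw w w' w" using shadow_convex w by blast
  then have "w' = w" by (rule btw_same)
  then have "btw d w x" using A x dA btw_median[of w x d] btw_commute unfolding w'_def by metis
  then show "w \<in> {u. \<exists>c\<in>C. btw c u x}" using dC by auto
qed

definition bool_hom :: "('a \<Rightarrow> bool) \<Rightarrow> bool" where
  "bool_hom g \<longleftrightarrow> (\<forall>x\<in>A. \<forall>y\<in>A. \<forall>z\<in>A.
     g (\<mu> x y z) \<longleftrightarrow> (g x \<and> g y) \<or> (g y \<and> g z) \<or> (g x \<and> g z))"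

lemma bool_homD:
  "bool_hom g \<Longrightarrow> x \<in> A \<Longrightarrow> y \<in> A \<Longrightarrow> z \<in> A \<Longrightarrow>
     g (\<mu> x y z) \<longleftrightarrow> (g x \<and> g y) \<or> (g y \<and> g z) \<or> (g x \<and> g z)"
  by (auto simp: bool_hom_def)

lemma bool_hom_halfspace:
  assumes "convex_in C" "convex_in (A - C)"
  shows "bool_hom (\<lambda>x. x \<in> C)"
  unfolding bool_hom_def
proof (intro ballI)
  fix x y z assume A: "x \<in> A" "y \<in> A" "z \<in> A"
  note b = btw_median[OF A] and cl = closed[OF A]
  show "\<mu> x y z \<in> C \<longleftrightarrow> (x \<in> C \<and> y \<in> C) \<or> (y \<in> C \<and> z \<in> C) \<or> (x \<in> C \<and> z \<in> C)"
    using assms b cl A unfolding convex_in_def by (meson DiffD2 DiffI)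
qed

text \<open>Points are separated by homomorphisms to the two-point median algebra.  A maximal convex set
  \<open>C\<close> that contains \<open>a\<close> and not \<open>b\<close> is a half-space: for \<open>x\<close> outside \<open>C\<close> the join of \<open>C\<close> and \<open>x\<close>
  contains \<open>b\<close>, so \<open>x\<close> is in the shadow of \<open>b\<close> seen from some point of \<open>C\<close>, and two such points
  \<open>x\<close>, \<open>y\<close> are in the shadow of \<open>b\<close> seen from one common point of \<open>C\<close>.\<close>

theorem separation:
  assumes a: "a \<in> A" and b: "b \<in> A" and ab: "a \<noteq> b"
  obtains g where "bool_hom g" "g a" "\<not> g b"
proof -
  define F where "F = {C. convex_in C \<and> a \<in> C \<and> b \<notin> C}"
  have single: "{a} \<in> F" using a ab btw_same by (auto simp: F_def convex_in_def)
  have chain: "\<Union>\<C> \<in> F" if "\<C> \<noteq> {}" "subset.chain F \<C>" for \<C>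
  proof -
    have sub: "\<C> \<subseteq> F" using that(2) by (auto simp: subset.chain_def)
    have "convex_in (\<Union>\<C>)"
      unfolding convex_in_def
    proof (intro conjI ballI allI impI)
      show "\<Union>\<C> \<subseteq> A" using sub convex_in_subset unfolding F_def by blast
    next
      fix x y z assume "x \<in> \<Union>\<C>" "y \<in> \<Union>\<C>" and z: "btw x z y"
      then obtain C D where CD: "x \<in> C" "C \<in> \<C>" "y \<in> D" "D \<in> \<C>" by auto
      then have "C \<subseteq> D \<or> D \<subseteq> C" using that(2) unfolding subset.chain_def by blast
      then obtain E where "x \<in> E" "y \<in> E" "E \<in> \<C>" using CD by blast
      moreover have "convex_in E" using \<open>E \<in> \<C>\<close> sub by (auto simp: F_def)
      ultimately show "z \<in> \<Union>\<C>" using z convex_inD by blast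
    qed
    then show ?thesis using sub that(1) unfolding F_def by blast
  qed
  have "\<exists>C\<in>F. \<forall>D\<in>F. C \<subseteq> D \<longrightarrow> D = C"
  proof (rule subset_Zorn_nonempty)
    show "F \<noteq> {}" using single by blast
  qed (fact chain)
  then obtain C where CF: "C \<in> F" and max: "\<And>D. D \<in> F \<Longrightarrow> C \<subseteq> D \<Longrightarrow> D = C"
    by blast
  have C: "convex_in C" "a \<in> C" "b \<notin> C" using CF by (auto simp: F_def)
  then have CA: "C \<subseteq> A" by (intro convex_in_subset)
  have shadow: "\<exists>c\<in>C. btw c b x" if x: "x \<in> A - C" for x
  proof (rule ccontr)
    assume neg: "\<not> (\<exists>c\<in>C. btw c b x)"
    let ?J = "{u. \<exists>c\<in>C. btw c u x}"
    have sub: "C \<subseteq> ?J" using x CA btw_left by auto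
    have "x \<in> ?J" using x C CA btw_right by auto
    then have "?J \<noteq> C" using x by auto
    moreover have "?J \<in> F" using neg join_convex[OF C(1), of x] x sub C by (auto simp: F_def)
    ultimately show False using max sub by blast
  qed
  have "convex_in (A - C)"
    unfolding convex_in_def
  proof (intro conjI ballI allI impI)
    fix x y z assume xy: "x \<in> A - C" "y \<in> A - C" and z: "btw x z y"
    obtain c c' where c: "c \<in> C" "btw c b x" "c' \<in> C" "btw c' b y" using shadow xy by metis
    have A: "c \<in> A" "c' \<in> A" using c btwD by auto
    define e where "e = \<mu> c c' b"
    have e: "btw c e c'" "btw c e b" "btw c' e b" using btw_median[OF A b] by (auto simp: e_def)
    have eC: "e \<in> C" using convex_inD[OF C(1) c(1,3) e(1)] .
    have "btw e b x" "btw e b y" using btw_trans2 c e by auto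
    then have "btw e b z" using z shadow_convex by blast
    then have "z \<notin> C" using eC C convex_inD by blast
    then show "z \<in> A - C" using z btwD by auto
  qed auto
  then show ?thesis using that[of "\<lambda>x. x \<in> C"] bool_hom_halfspace C by auto
qed

lemma eqI_bool_hom:
  assumes "a \<in> A" "b \<in> A" and "\<And>g. bool_hom g \<Longrightarrow> g a = g b"
  shows "a = b"
  using assms separation by metis

sublocale median_algebra A \<mu>
proof
  show "\<mu> a b (\<mu> c d e) = \<mu> (\<mu> a b c) (\<mu> a b d) e"
    if "a \<in> A" "b \<in> A" "c \<in> A" "d \<in> A" "e \<in> A" for a b c d e
    using that by (intro eqI_bool_hom) (auto simp: closed bool_homD)
qed (use closed idem symm in auto)

text \<open>A homomorphism to the two-point algebra is determined by its values on generators, so a set of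
  \<open>k\<close> generators admits at most \<open>2 ^ k\<close> of them; by separation a point is determined by the
  homomorphisms that are true at it.\<close>

lemma finitely_generated_finite:
  assumes G: "finite G" "G \<subseteq> A"
    and gen: "\<And>S. G \<subseteq> S \<Longrightarrow> median_subalgebra S A \<mu> \<Longrightarrow> S = A"
  shows "finite A"
proof -
  define \<Phi> where "\<Phi> = (\<lambda>x. {{y \<in> G. g y} |g. bool_hom g \<and> g x})"
  have eq: "g x = g' x"
    if g: "bool_hom g" "bool_hom g'" "{y \<in> G. g y} = {y \<in> G. g' y}" and x: "x \<in> A" for g g' x
  proof -
    have "{x \<in> A. g x = g' x} = A"
    proof (rule gen)
      show "G \<subseteq> {x \<in> A. g x = g' x}" using g(3) G(2) by auto
      show "median_subalgebra {x \<in> A. g x = g' x} A \<mu>"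
        using g(1,2) by (auto simp: median_subalgebra_def closed bool_homD)
    qed
    then show ?thesis using x by auto
  qed
  have "inj_on \<Phi> A"
  proof (rule inj_onI, rule ccontr)
    fix x y assume xy: "x \<in> A" "y \<in> A" "\<Phi> x = \<Phi> y" "x \<noteq> y"
    obtain g where g: "bool_hom g" "g x" "\<not> g y" using separation xy by metis
    then have "{y \<in> G. g y} \<in> \<Phi> y" using xy(3) by (auto simp: \<Phi>_def)
    then obtain g' where "bool_hom g'" "g' y" "{y \<in> G. g y} = {y \<in> G. g' y}"
      by (auto simp: \<Phi>_def)
    then show False using eq[of g g' y] g xy by auto
  qed
  moreover have "\<Phi> ` A \<subseteq> Pow (Pow G)" by (auto simp: \<Phi>_def)
  ultimately show ?thesis using G(1) by (meson finite_Pow_iff finite_subset inj_on_finite)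
qed

section \<open>Cubes and rank\<close>

lemma bool_hom_not: "bool_hom g \<Longrightarrow> bool_hom (\<lambda>x. \<not> g x)"
  by (auto simp: bool_hom_def)

lemma eqI_bool_hom_based:
  assumes "a \<in> A" "b \<in> A" and *: "\<And>g. bool_hom g \<Longrightarrow> \<not> g p \<Longrightarrow> g a = g b"
  shows "a = b"
proof (rule eqI_bool_hom[OF assms(1,2)])
  fix g assume "bool_hom g"
  then show "g a = g b" using *[of g] *[of "\<lambda>x. \<not> g x"] bool_hom_not by (cases "g p") auto
qed

text \<open>The interval from \<open>p\<close> to \<open>q\<close> is a distributive lattice with least element \<open>p\<close>, in which
  \<open>\<mu> q\<close> is the join.\<close>

definition join :: "'a \<Rightarrow> 'a list \<Rightarrow> 'a \<Rightarrow> 'a" where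
  "join q ys p = foldr (\<mu> q) ys p"

lemma join_closed: "q \<in> A \<Longrightarrow> p \<in> A \<Longrightarrow> set ys \<subseteq> A \<Longrightarrow> join q ys p \<in> A"
  by (induction ys) (auto simp: join_def closed)

lemma bool_hom_join:
  assumes "bool_hom g" "q \<in> A" "p \<in> A" "set ys \<subseteq> A" "\<not> g p" "\<And>y. y \<in> set ys \<Longrightarrow> g y \<Longrightarrow> g q"
  shows "g (join q ys p) \<longleftrightarrow> (\<exists>y\<in>set ys. g y)"
  using assms(4,6)
proof (induction ys)
  case Nil
  then show ?case using assms by (simp add: join_def)
next
  case (Cons y ys)
  then have *: "g (join q ys p) \<longleftrightarrow> (\<exists>y\<in>set ys. g y)" "join q ys p \<in> A" "y \<in> A"
    using join_closed assms by auto
  have "join q (y # ys) p = \<mu> q y (join q ys p)" by (simp add: join_def)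
  then show ?case using * Cons.prems assms(1,2) by (auto simp: bool_homD)
qed

text \<open>Elements \<open>z i\<close> of a distributive lattice with pairwise meet the least element generate a Boolean
  algebra: the subsets of the index set correspond to the joins of the \<open>z i\<close> over them.  A
  homomorphism that is false at the bottom is true at one \<open>z i\<close> at most, so the required identities
  can be checked on truth values.\<close>

lemma rank_ge_disjoint:
  assumes s: "s \<in> A" and z: "\<And>i. i < m \<Longrightarrow> btw s (z i) q" "\<And>i. i < m \<Longrightarrow> z i \<noteq> s"
    and q: "q \<in> A"
    and disj: "\<And>i j. i < m \<Longrightarrow> j < m \<Longrightarrow> i \<noteq> j \<Longrightarrow> \<mu> s (z i) (z j) = s"
  shows "enat m \<le> median_rank A \<mu>"
proof -
  define f where "f = (\<lambda>T. join q (map z (filter T [0..<m])) s)"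
  have zA: "z i \<in> A" if "i < m" for i using z(1)[OF that] btwD by auto
  have fA: "f T \<in> A" for T using q s zA by (auto simp: f_def intro!: join_closed)
  have gf: "g (f T) \<longleftrightarrow> (\<exists>i<m. T i \<and> g (z i))" if g: "bool_hom g" "\<not> g s" for g T
  proof -
    have "g q" if "i < m" "g (z i)" for i
      using bool_homD[OF g(1) s zA[OF that(1)] q] z(1)[OF that(1)] g that by (auto simp: btw_def)
    then show ?thesis unfolding f_def using g q s zA by (subst bool_hom_join) auto
  qed
  have one: "i = j" if g: "bool_hom g" "\<not> g s" and ij: "i < m" "j < m" "g (z i)" "g (z j)" for g i j
    using bool_homD[OF g(1) s zA[OF ij(1)] zA[OF ij(2)]] disj[OF ij(1,2)] g ij by metis
  have hom: "f (cube_median m x y w) = \<mu> (f x) (f y) (f w)" for x y w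
  proof (rule eqI_bool_hom_based[where p = s])
    fix g assume g: "bool_hom g" "\<not> g s"
    show "g (f (cube_median m x y w)) = g (\<mu> (f x) (f y) (f w))"
    proof (cases "\<exists>i<m. g (z i)")
      case True
      then obtain i where i: "i < m" "g (z i)" by auto
      have "g (f T) \<longleftrightarrow> T i" for T using gf[OF g] one[OF g] i by blast
      then show ?thesis using i bool_homD[OF g(1) fA fA fA] by (simp add: cube_median_def)
    next
      case False
      then have "\<not> g (f T)" for T using gf[OF g] by blast
      then show ?thesis using bool_homD[OF g(1) fA fA fA] by simp
    qed
  qed (use fA closed in auto)
  have "inj_on f (cube m)"
  proof (rule inj_onI, rule ccontr)
    fix x y assume xy: "x \<in> cube m" "y \<in> cube m" "f x = f y" "x \<noteq> y"
    then have "\<exists>i<m. x i \<noteq> y i"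
      using PiE_ext[of x "{..<m}" "\<lambda>_. UNIV" y] unfolding cube_def by blast
    then obtain i where i: "i < m" "x i \<noteq> y i" by blast
    have "z i = s"
    proof (rule eqI_bool_hom_based[where p = s])
      fix g assume g: "bool_hom g" "\<not> g s"
      have "\<not> g (z i)"
      proof
        assume gi: "g (z i)"
        have "g (f T) \<longleftrightarrow> T i" for T using gf[OF g] one[OF g] i gi by blast
        then show False using xy(3) i(2) by metis
      qed
      then show "g (z i) = g s" using g by simp
    qed (use zA i s in auto)
    then show False using z(2) i by blast
  qed
  moreover have "cube_median m x y w \<in> cube m" for x y w
    by (auto simp: cube_def cube_median_def)
  ultimately have "median_isomorphic (cube m) (cube_median m) (f ` cube m) \<mu>"
    "median_subalgebra (f ` cube m) A \<mu>"
    unfolding median_isomorphic_def median_subalgebra_def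
    using fA hom by (auto simp: bij_betw_def simp flip: hom)
  then show ?thesis unfolding median_rank_def by (intro Sup_upper) blast
qed

text \<open>The exact form of thinness, by an argument in the lattice between \<open>p\<close> and \<open>q\<close>.  Let \<open>y i\<close> be
  the projection of \<open>x i\<close> to this lattice and \<open>s\<close> the join of all pairwise meets of the \<open>y i\<close>.  The
  joins of \<open>s\<close> with the \<open>y i\<close> have pairwise meet \<open>s\<close>; if no \<open>y i\<close> were below \<open>s\<close>, they would span an
  \<open>(n + 1)\<close>-cube.\<close>

lemma rank_le_imp_below_join:
  assumes rank: "median_rank A \<mu> \<le> enat n" and x: "\<And>i. i \<in> {1..n+1} \<Longrightarrow> x i \<in> A"
    and p: "p \<in> A" and q: "q \<in> A" and ps: "set ps = distinct_pairs n"
    and s: "s = join q (map (\<lambda>(i, j). \<mu> (\<mu> (x i) (x j) p) p q) ps) p"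
  shows "\<exists>i\<in>{1..n+1}. \<mu> p (\<mu> (x i) p q) s = \<mu> (x i) p q"
proof (rule ccontr)
  assume neg: "\<not> ?thesis"
  let ?w = "\<lambda>i j. \<mu> (\<mu> (x i) (x j) p) p q"
  have wA: "?w i j \<in> A" if "(i, j) \<in> distinct_pairs n" for i j
    using that x p q by (auto simp: distinct_pairs_def closed)
  have sA: "s \<in> A" unfolding s using wA ps q p by (intro join_closed) auto
  have gs: "g s \<longleftrightarrow> g q \<and> (\<exists>i j. (i, j) \<in> distinct_pairs n \<and> g (x i) \<and> g (x j))"
    if g: "bool_hom g" "\<not> g p" for g
  proof -
    have w: "g (?w i j) \<longleftrightarrow> g (x i) \<and> g (x j) \<and> g q" if "(i, j) \<in> distinct_pairs n" for i j
      using that x p q g by (auto simp: distinct_pairs_def bool_homD closed)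
    have "g s \<longleftrightarrow> (\<exists>y\<in>set (map (\<lambda>(i, j). ?w i j) ps). g y)"
      unfolding s using g p q wA w ps by (intro bool_hom_join) auto
    also have "\<dots> \<longleftrightarrow> (\<exists>i j. (i, j) \<in> distinct_pairs n \<and> g (?w i j))"
      by (force simp: ps)
    also have "\<dots> \<longleftrightarrow> (\<exists>i j. (i, j) \<in> distinct_pairs n \<and> g (x i) \<and> g (x j) \<and> g q)"
      by (simp add: w cong: conj_cong)
    finally show ?thesis by blast
  qed
  define z where "z = (\<lambda>i. \<mu> s q (\<mu> (x (i+1)) p q))"
  have zA: "z i \<in> A" if "i < n + 1" for i
    using that x[of "i+1"] p q sA by (simp add: z_def closed)
  have gz: "g (z i) \<longleftrightarrow> g s \<or> (g (x (i+1)) \<and> g q)" if g: "bool_hom g" "\<not> g p" "i < n + 1" for g i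
    using g x[of "i+1"] p q sA gs[OF g(1,2)] by (auto simp: z_def bool_homD closed)
  have "enat (n+1) \<le> median_rank A \<mu>"
  proof (rule rank_ge_disjoint[of s "n+1" z q])
    fix i assume i: "i < n + 1"
    have xi: "x (i+1) \<in> A" using i x by auto
    show "btw s (z i) q" using i x[of "i+1"] p q sA unfolding z_def by (intro btw_median) (auto simp: closed)
    show "z i \<noteq> s"
    proof
      assume zs: "z i = s"
      have "\<mu> p (\<mu> (x (i+1)) p q) s = \<mu> (x (i+1)) p q"
      proof (rule eqI_bool_hom_based[where p = p])
        fix g assume g: "bool_hom g" "\<not> g p"
        show "g (\<mu> p (\<mu> (x (i+1)) p q) s) = g (\<mu> (x (i+1)) p q)"
          using gz[OF g i] g p q xi sA zs by (auto simp: closed bool_homD)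
      qed (use xi p q sA closed in auto)
      then show False using neg i by auto
    qed
    fix j assume j: "j < n + 1" "i \<noteq> j"
    have ij: "(i+1, j+1) \<in> distinct_pairs n" using i j by (auto simp: distinct_pairs_def)
    show "\<mu> s (z i) (z j) = s"
    proof (rule eqI_bool_hom_based[where p = p])
      fix g assume g: "bool_hom g" "\<not> g p"
      have "g s" if "g (x (i+1))" "g (x (j+1))" "g q" using gs[OF g] ij that by blast
      then show "g (\<mu> s (z i) (z j)) = g s"
        using gz[OF g i] gz[OF g j(1)] bool_homD[OF g(1) sA zA[OF i] zA[OF j(1)]] by blast
    qed (use sA zA i j closed in auto)
  qed (use sA q in auto)
  then have "enat (n+1) \<le> enat n" using rank by (rule order_trans)
  then show False by simp
qed

end

text \<open>Conversely, an algebra of larger rank contains the configuration that thinness excludes: a corner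
  \<open>p\<close> of a cube, the neighbours \<open>x i\<close> of \<open>p\<close>, and the opposite corner \<open>q\<close>.\<close>

lemma rank_gt_imp_corner:
  assumes "\<not> median_rank A \<mu> \<le> enat n"
  obtains x p q where "p \<in> A" "q \<in> A"
    "\<And>i. i \<in> {1..n+1} \<Longrightarrow> x i \<in> A \<and> x i \<noteq> p \<and> \<mu> (x i) p q = x i"
    "\<And>i j. (i, j) \<in> distinct_pairs n \<Longrightarrow> \<mu> (x i) (x j) p = p"
proof -
  from assms obtain m S where m: "n < m" and S: "median_subalgebra S A \<mu>"
    "median_isomorphic (cube m) (cube_median m) S \<mu>"
    unfolding median_rank_def Sup_le_iff by (auto simp: not_le)
  then obtain f where bij: "bij_betw f (cube m) S"
    and f: "\<And>x y z. x \<in> cube m \<Longrightarrow> y \<in> cube m \<Longrightarrow> z \<in> cube m \<Longrightarrow>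
              \<mu> (f x) (f y) (f z) = f (cube_median m x y z)"
    unfolding median_isomorphic_def by metis
  \<comment> \<open>Coordinates are counted from 0 and the neighbours of the corner from 1.\<close>
  define o' where "o' = (\<lambda>k\<in>{..<m}. False)"
  define e where "e = (\<lambda>i::nat. \<lambda>k\<in>{..<m}. k + 1 = i)"
  define u where "u = (\<lambda>k\<in>{..<m}. True)"
  have C: "o' \<in> cube m" "e i \<in> cube m" "u \<in> cube m" for i
    by (auto simp: o'_def e_def u_def cube_def)
  have fA: "f x \<in> A" if "x \<in> cube m" for x
    using that bij S(1) by (auto simp: bij_betw_def median_subalgebra_def)
  show ?thesis
  proof (rule that[of "f o'" "f u" "\<lambda>i. f (e i)"])
    fix i assume i: "i \<in> {1..n+1}"
    have "e i (i - 1)" "\<not> o' (i - 1)" using i m by (auto simp: e_def o'_def)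
    then have "f (e i) \<noteq> f o'" using bij C inj_on_eq_iff unfolding bij_betw_def by metis
    moreover have "cube_median m (e i) o' u = e i"
      by (auto simp: cube_median_def e_def o'_def u_def)
    ultimately show "f (e i) \<in> A \<and> f (e i) \<noteq> f o' \<and> \<mu> (f (e i)) (f o') (f u) = f (e i)"
      using C fA f by auto
  next
    fix i j assume "(i, j) \<in> distinct_pairs n"
    then have "cube_median m (e i) (e j) o' = o'"
      by (auto simp: cube_median_def e_def o'_def distinct_pairs_def intro!: restrict_ext)
    then show "\<mu> (f (e i)) (f (e j)) (f o') = f o'" using C f by auto
  qed (use C fA in auto)
qed

lemma rank_le_transport:
  assumes "inj_on e A" and closed: "\<And>x y z. x \<in> A \<Longrightarrow> y \<in> A \<Longrightarrow> z \<in> A \<Longrightarrow> \<mu> x y z \<in> A"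
    and \<nu>: "\<And>x y z. x \<in> A \<Longrightarrow> y \<in> A \<Longrightarrow> z \<in> A \<Longrightarrow> \<nu> (e x) (e y) (e z) = e (\<mu> x y z)"
  shows "median_rank (e ` A) \<nu> \<le> median_rank A \<mu>"
  unfolding median_rank_def
proof (rule Sup_subset_mono, clarify)
  fix m S assume S: "median_subalgebra S (e ` A) \<nu>" "median_isomorphic (cube m) (cube_median m) S \<nu>"
  define d where "d = inv_into A e"
  have SA: "S \<subseteq> e ` A" using S(1) by (auto simp: median_subalgebra_def)
  have d: "d x \<in> A" "e (d x) = x" if "x \<in> S" for x
    using that SA by (auto simp: d_def inv_into_into f_inv_into_f)
  have dh: "d (\<nu> x y z) = \<mu> (d x) (d y) (d z)" if "x \<in> S" "y \<in> S" "z \<in> S" for x y z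
  proof -
    have "\<nu> x y z = e (\<mu> (d x) (d y) (d z))" using that d \<nu> by metis
    then show ?thesis using that d assms(1) closed unfolding d_def by (metis inv_into_f_f)
  qed
  have sub: "\<nu> x y z \<in> S" if "x \<in> S" "y \<in> S" "z \<in> S" for x y z
    using S(1) that by (auto simp: median_subalgebra_def)
  obtain f where f: "bij_betw f (cube m) S" "\<And>x y z. x \<in> cube m \<Longrightarrow> y \<in> cube m \<Longrightarrow> z \<in> cube m \<Longrightarrow>
              f (cube_median m x y z) = \<nu> (f x) (f y) (f z)"
    using S(2) unfolding median_isomorphic_def by metis
  have fS: "f x \<in> S" if "x \<in> cube m" for x using that f(1) by (auto simp: bij_betw_def)
  have "bij_betw d S (d ` S)" using d(2) by (metis bij_betw_def inj_onI)
  then have "bij_betw (d \<circ> f) (cube m) (d ` S)" using f(1) bij_betw_trans by blast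
  then have "median_isomorphic (cube m) (cube_median m) (d ` S) \<mu>"
    unfolding median_isomorphic_def by (intro exI[of _ "d \<circ> f"]) (auto simp: f(2) dh fS)
  moreover have "median_subalgebra (d ` S) A \<mu>"
    unfolding median_subalgebra_def using d dh sub by (auto simp flip: dh)
  ultimately show "\<exists>m'. enat m = enat m' \<and> (\<exists>S. median_subalgebra S A \<mu> \<and>
      median_isomorphic (cube m') (cube_median m') S \<mu>)" by blast
qed

lemma associative_median_of_median_algebra:
  assumes "median_algebra A \<mu>"
  shows "associative_median A \<mu>"
proof -
  interpret median_algebra A \<mu> by fact
  show ?thesis
  proof
    fix a b c d assume A: "a \<in> A" "b \<in> A" "c \<in> A" "d \<in> A"
    have "\<mu> a b (\<mu> c b d) = \<mu> (\<mu> a b c) (\<mu> a b b) d" using A by (intro M3)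
    moreover have "\<mu> a b b = b" using A M1[of b a] M2 unfolding fully_symmetric_on_def by metis
    ultimately show "\<mu> (\<mu> a b c) b d = \<mu> a b (\<mu> c b d)" by simp
  qed (use closed M1 M2 in auto)
qed

section \<open>Bounded error in a coarse median space\<close>

context coarse_median_space
begin

lemma perm:
  "\<mu> a c b = \<mu> a b c" "\<mu> b a c = \<mu> a b c" "\<mu> b c a = \<mu> a b c"
  "\<mu> c a b = \<mu> a b c" "\<mu> c b a = \<mu> a b c"
  using M2 unfolding fully_symmetric_on_def by auto

lemma idem: "\<mu> a b a = a" "\<mu> b a a = a" "\<mu> a a b = a"
  using M1 perm(1)[where a=a and b=a and c=b] perm(4)[where a=a and b=a and c=b] by auto

lemma coarse_lipschitz:
  obtains L where "L \<ge> 0"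
    "\<And>a b c a' b' c'. dist (\<mu> a b c) (\<mu> a' b' c') \<le> L * (dist a a' + dist b b' + dist c c') + L"
proof -
  obtain \<rho> :: "real \<Rightarrow> real" and K k where \<rho>: "\<forall>t\<ge>0. \<rho> t = K * t + k"
    and lip: "\<And>a a' b c. dist (\<mu> a b c) (\<mu> a' b c) \<le> \<rho> (dist a a')"
    using C1 by blast
  define L where "L = \<bar>K\<bar> + 3 * \<bar>k\<bar>"
  have one: "dist (\<mu> a b c) (\<mu> a' b c) \<le> L * dist a a' + \<bar>k\<bar>" for a a' b c
  proof -
    have "dist (\<mu> a b c) (\<mu> a' b c) \<le> K * dist a a' + k" using lip[of a b c a'] \<rho> by simp
    also have "\<dots> \<le> L * dist a a' + \<bar>k\<bar>"
      by (intro add_mono mult_right_mono) (auto simp: L_def)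
    finally show ?thesis .
  qed
  show ?thesis
  proof (rule that[of L])
    fix a b c a' b' c'
    have "dist (\<mu> a b c) (\<mu> a' b' c') \<le> dist (\<mu> a b c) (\<mu> a' b c) +
        (dist (\<mu> a' b c) (\<mu> a' b' c) + dist (\<mu> a' b' c) (\<mu> a' b' c'))"
      by (meson add_left_mono dist_triangle order_trans)
    also have "\<dots> \<le> L * (dist a a' + dist b b' + dist c c') + 3 * \<bar>k\<bar>"
      using one[of a b c a'] one[of b a' c b'] one[of c a' b' c']
      by (simp add: algebra_simps perm(1,2))
    also have "3 * \<bar>k\<bar> \<le> L" by (simp add: L_def)
    finally show "dist (\<mu> a b c) (\<mu> a' b' c') \<le> L * (dist a a' + dist b b' + dist c c') + L"
      by simp
  qed (simp add: L_def)
qed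

text \<open>Summing the bounds for natural numbers makes them monotone.  This turns statements of the form
  "a bound on one quantity forces some bound on another" into the existence of a nondecreasing
  function.\<close>

lemma nondecreasing_bound:
  fixes P :: "real \<Rightarrow> real \<Rightarrow> bool"
  assumes ex: "\<And>R. \<exists>C. P R C" and up: "\<And>R C C'. P R C \<Longrightarrow> C \<le> C' \<Longrightarrow> P R C'"
    and down: "\<And>R R' C. P R' C \<Longrightarrow> R \<le> R' \<Longrightarrow> P R C"
  obtains f where "nondecreasing_nonneg f" "\<And>R. P R (f R)"
proof -
  obtain c where c: "\<And>R. P R (c R)" using ex by metis
  define f where "f = (\<lambda>R::real. \<Sum>k\<le>nat \<lceil>R\<rceil>. \<bar>c (real k)\<bar>)"
  have "mono f"
  proof (rule monoI)
    fix x y :: real assume "x \<le> y"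
    then have "nat \<lceil>x\<rceil> \<le> nat \<lceil>y\<rceil>" by (intro nat_mono ceiling_mono)
    then show "f x \<le> f y" unfolding f_def by (intro sum_mono2) auto
  qed
  moreover have "f R \<ge> 0" for R by (simp add: f_def sum_nonneg)
  ultimately have "nondecreasing_nonneg f"
    by (auto simp: nondecreasing_nonneg_def mono_on_def dest: monoD)
  moreover have "P R (f R)" for R
  proof -
    have "\<bar>c (nat \<lceil>R\<rceil>)\<bar> \<le> f R"
      unfolding f_def
      using member_le_sum[of "nat \<lceil>R\<rceil>" "{..nat \<lceil>R\<rceil>}" "\<lambda>k. \<bar>c (real k)\<bar>"] by simp
    then have "c (nat \<lceil>R\<rceil>) \<le> f R" by linarith
    then have "P (nat \<lceil>R\<rceil>) (f R)" using c up by blast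
    moreover have "R \<le> nat \<lceil>R\<rceil>" by linarith
    ultimately show ?thesis using down by blast
  qed
  ultimately show ?thesis using that by blast
qed

definition thin :: "nat \<Rightarrow> real \<Rightarrow> real \<Rightarrow> bool" where
  "thin n R C \<longleftrightarrow> (\<forall>x p q. (\<forall>(i, j)\<in>distinct_pairs n. dist p (\<mu> (x i) (x j) p) \<le> R) \<longrightarrow>
     (\<exists>i\<in>{1..n+1}. dist p (\<mu> (x i) p q) \<le> C))"

lemma finite_distinct_pairs: "finite (distinct_pairs n)"
  by (rule finite_subset[of _ "{1..n+1} \<times> {1..n+1}"]) (auto simp: distinct_pairs_def)

lemma thin_cubes_condition_iff:
  assumes "n \<noteq> 0"
  shows "thin_cubes_condition \<mu> n \<longleftrightarrow> (\<forall>R. \<exists>C. thin n R C)"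
proof -
  have ne: "distinct_pairs n \<noteq> {}" 
  proof -
    have "(1, 2) \<in> distinct_pairs n" using assms by (auto simp: distinct_pairs_def)
    then show ?thesis by blast
  qed
  define M where "M = (\<lambda>x p. Max ((\<lambda>(i, j). dist p (\<mu> (x i) (x j) p)) ` distinct_pairs n))"
  have M: "M x p \<le> R \<longleftrightarrow> (\<forall>(i, j)\<in>distinct_pairs n. dist p (\<mu> (x i) (x j) p) \<le> R)" for x p R
    unfolding M_def using ne finite_distinct_pairs by (subst Max_le_iff) auto
  have Mn: "M x p \<ge> 0" for x p
  proof -
    obtain y where y: "y \<in> distinct_pairs n" using ne by auto
    have "0 \<le> (\<lambda>(i, j). dist p (\<mu> (x i) (x j) p)) y" by (auto split: prod.splits)
    also have "\<dots> \<le> M x p" unfolding M_def using finite_distinct_pairs y by (intro Max_ge) auto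
    finally show ?thesis .
  qed
  have m: "Min ((\<lambda>i. dist p (\<mu> (x i) p q)) ` {1..n + 1}) \<le> C \<longleftrightarrow>
    (\<exists>i\<in>{1..n+1}. dist p (\<mu> (x i) p q) \<le> C)" for x p q C
    by (subst Min_le_iff) auto
  have thin: "thin n R C \<longleftrightarrow> (\<forall>x p q. M x p \<le> R \<longrightarrow> (\<exists>i\<in>{1..n+1}. dist p (\<mu> (x i) p q) \<le> C))" for R C
    by (simp add: thin_def M)
  have cond: "thin_cubes_condition \<mu> n \<longleftrightarrow> (\<exists>\<phi>. nondecreasing_nonneg \<phi> \<and>
    (\<forall>x p q. \<exists>i\<in>{1..n+1}. dist p (\<mu> (x i) p q) \<le> \<phi> (M x p)))"
    unfolding thin_cubes_condition_def m by (simp only: M_def)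
  show ?thesis
  proof
    assume "thin_cubes_condition \<mu> n"
    then obtain \<phi> where \<phi>: "nondecreasing_nonneg \<phi>"
      "\<And>x p q. \<exists>i\<in>{1..n+1}. dist p (\<mu> (x i) p q) \<le> \<phi> (M x p)"
      unfolding cond by blast
    have "thin n R (\<phi> R)" for R
      unfolding thin
    proof (intro allI impI)
      fix x p q assume "M x p \<le> R"
      then have "\<phi> (M x p) \<le> \<phi> R"
        using \<phi>(1) Mn[of x p] unfolding nondecreasing_nonneg_def by (auto elim!: mono_onD)
      then show "\<exists>i\<in>{1..n+1}. dist p (\<mu> (x i) p q) \<le> \<phi> R" using \<phi>(2)[of p x q] by force
    qed
    then show "\<forall>R. \<exists>C. thin n R C" by blast
  next
    assume ex: "\<forall>R. \<exists>C. thin n R C"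
    obtain \<phi> where "nondecreasing_nonneg \<phi>" "\<And>R. thin n R (\<phi> R)"
    proof (rule nondecreasing_bound[of "thin n"])
      show "\<exists>C. thin n R C" for R using ex by blast
      show "thin n R C'" if "thin n R C" "C \<le> C'" for R C C'
        using that unfolding thin by (meson order_trans)
      show "thin n R C" if "thin n R' C" "R \<le> R'" for R R' C
        using that unfolding thin by (meson order_trans)
    qed blast
    then show "thin_cubes_condition \<mu> n" unfolding cond thin by blast
  qed
qed

text \<open>A point is close to the interval from \<open>a\<close> to \<open>b\<close> iff it is close to its projection
  \<open>\<mu> a b p\<close>: by the four-point inequality the projection almost fixes the interval.\<close>

lemma near_projection_imp_near_interval:
  "dist p (\<mu> a b p) \<le> r \<Longrightarrow> p \<in> nbhd r (interval \<mu> a b)"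
  unfolding nbhd_def interval_def using perm(1)[where a=a and b=p and c=b] by force

lemma near_interval_imp_near_projection:
  "\<exists>D. \<forall>a b p. p \<in> nbhd r (interval \<mu> a b) \<longrightarrow> dist p (\<mu> a b p) \<le> D"
proof -
  obtain \<kappa> where \<kappa>: "\<And>a b c d. dist (\<mu> (\<mu> a b c) b d) (\<mu> a b (\<mu> c b d)) \<le> \<kappa>"
    using C2 by blast
  obtain L where L: "L \<ge> 0"
    "\<And>a b c a' b' c'. dist (\<mu> a b c) (\<mu> a' b' c') \<le> L * (dist a a' + dist b b' + dist c c') + L"
    using coarse_lipschitz by blast
  show ?thesis
  proof (intro exI allI impI)
    fix a b p assume "p \<in> nbhd r (interval \<mu> a b)"
    then obtain y where y: "dist p (\<mu> a y b) \<le> r"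
      unfolding nbhd_def interval_def by auto
    let ?m = "\<mu> a y b"
    have "dist p (\<mu> a b p) \<le> dist p ?m + (dist ?m (\<mu> a b ?m) + dist (\<mu> a b ?m) (\<mu> a b p))"
      by (meson add_left_mono dist_triangle order_trans)
    also have "dist ?m (\<mu> a b ?m) \<le> \<kappa>"
      using \<kappa>[of y a b b] perm(3)[where a="?m" and b=a and c=b] perm(2)[where a=a and b=y and c=b] idem(1)[where a=b and b=a]
      by (simp add: dist_commute)
    also have "dist (\<mu> a b ?m) (\<mu> a b p) \<le> L * r + L"
      using L(2)[of a b ?m a b p] mult_left_mono[OF y L(1)] by (simp add: dist_commute)
    also note y
    finally show "dist p (\<mu> a b p) \<le> r + (\<kappa> + (L * r + L))" by simp
  qed
qed

lemma multi_median_condition_iff: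
  "multi_median_condition \<mu> n \<longleftrightarrow> (\<forall>R. \<exists>C. thin n R C)"
proof
  assume "multi_median_condition \<mu> n"
  then obtain \<psi> where \<psi>: "\<And>r x q. r > 0 \<Longrightarrow>
      (\<Inter>(i, j)\<in>distinct_pairs n. nbhd r (interval \<mu> (x i) (x j)))
        \<subseteq> (\<Union>i\<in>{1..n + 1}. nbhd (\<psi> r) (interval \<mu> (x i) q))"
    unfolding multi_median_condition_def by blast
  show "\<forall>R. \<exists>C. thin n R C"
  proof
    fix R :: real
    define r where "r = max R 1"
    obtain D where D: "\<And>a b p. p \<in> nbhd (\<psi> r) (interval \<mu> a b) \<Longrightarrow> dist p (\<mu> a b p) \<le> D"
      using near_interval_imp_near_projection by blast
    have "thin n R D"
      unfolding thin_def
    proof (intro allI impI)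
      fix x p q assume *: "\<forall>(i, j)\<in>distinct_pairs n. dist p (\<mu> (x i) (x j) p) \<le> R"
      have "p \<in> nbhd r (interval \<mu> (x i) (x j))" if "(i, j) \<in> distinct_pairs n" for i j
        using * that by (intro near_projection_imp_near_interval) (auto simp: r_def)
      then have p: "p \<in> (\<Inter>(i, j)\<in>distinct_pairs n. nbhd r (interval \<mu> (x i) (x j)))" by blast
      have "r > 0" by (simp add: r_def)
      then have "p \<in> (\<Union>i\<in>{1..n+1}. nbhd (\<psi> r) (interval \<mu> (x i) q))"
        using p by (rule subsetD[OF \<psi>])
      then obtain i where "i \<in> {1..n+1}" "p \<in> nbhd (\<psi> r) (interval \<mu> (x i) q)"
        by (rule UN_E)
      then have "i \<in> {1..n+1}" "dist p (\<mu> (x i) p q) \<le> D"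
        using D[of p "x i" q] perm(1)[where a="x i" and b=q and c=p] by simp_all
      then show "\<exists>i\<in>{1..n+1}. dist p (\<mu> (x i) p q) \<le> D" ..
    qed
    then show "\<exists>C. thin n R C" ..
  qed
next
  assume thin: "\<forall>R. \<exists>C. thin n R C"
  define P where "P = (\<lambda>r C. \<forall>x q p.
    (\<forall>(i, j)\<in>distinct_pairs n. p \<in> nbhd r (interval \<mu> (x i) (x j))) \<longrightarrow>
    (\<exists>i\<in>{1..n+1}. p \<in> nbhd C (interval \<mu> (x i) q)))"
  have nbhd_mono: "p \<in> nbhd r S \<Longrightarrow> r \<le> r' \<Longrightarrow> p \<in> nbhd r' S" for p :: 'a and r r' S
    unfolding nbhd_def by force
  obtain \<psi> where "nondecreasing_nonneg \<psi>" and \<psi>: "\<And>r. P r (\<psi> r)"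
  proof (rule nondecreasing_bound[of P])
    fix r :: real
    obtain D where D: "\<And>a b p. p \<in> nbhd r (interval \<mu> a b) \<Longrightarrow> dist p (\<mu> a b p) \<le> D"
      using near_interval_imp_near_projection by blast
    obtain C where C: "thin n D C" using thin by blast
    have "P r C"
      unfolding P_def
    proof (intro allI impI)
      fix x q p assume *: "\<forall>(i, j)\<in>distinct_pairs n. p \<in> nbhd r (interval \<mu> (x i) (x j))"
      then have "\<forall>(i, j)\<in>distinct_pairs n. dist p (\<mu> (x i) (x j) p) \<le> D" using D by fast
      then obtain i where "i \<in> {1..n+1}" "dist p (\<mu> (x i) p q) \<le> C"
        using C unfolding thin_def by blast
      then have "i \<in> {1..n+1}" "p \<in> nbhd C (interval \<mu> (x i) q)"
        using near_projection_imp_near_interval[of p "x i" q C] perm(1)[where a="x i" and b=q and c=p]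
        by simp_all
      then show "\<exists>i\<in>{1..n+1}. p \<in> nbhd C (interval \<mu> (x i) q)" ..
    qed
    then show "\<exists>C. P r C" ..
  next
    show "P r C'" if "P r C" "C \<le> C'" for r C C'
      using that nbhd_mono unfolding P_def by meson
    show "P r C" if "P r' C" "r \<le> r'" for r r' C
      using that nbhd_mono unfolding P_def by fast
  qed blast
  moreover have "(\<Inter>(i, j)\<in>distinct_pairs n. nbhd r (interval \<mu> (x i) (x j)))
            \<subseteq> (\<Union>i\<in>{1..n + 1}. nbhd (\<psi> r) (interval \<mu> (x i) q))" for r x q
    using \<psi>[of r] unfolding P_def by fast
  ultimately show "multi_median_condition \<mu> n"
    unfolding multi_median_condition_def by blast
qed

section \<open>Bounded rank implies thin cubes\<close>

definition approximated :: "nat \<Rightarrow> 'a set \<Rightarrow> real \<Rightarrow> bool" where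
  "approximated n A h \<longleftrightarrow> (\<exists>(P :: nat set) \<nu> (\<pi> :: 'a \<Rightarrow> nat) (l :: nat \<Rightarrow> 'a).
     finite P \<and> median_algebra P \<nu> \<and> median_rank P \<nu> \<le> enat n \<and> \<pi> ` A \<subseteq> P \<and>
     (\<forall>x\<in>P. \<forall>y\<in>P. \<forall>z\<in>P. dist (l (\<nu> x y z)) (\<mu> (l x) (l y) (l z)) \<le> h) \<and>
     (\<forall>a\<in>A. dist a (l (\<pi> a)) \<le> h))"

lemma coarse_median_rank_le_iff:
  "coarse_median_rank_le \<mu> n \<longleftrightarrow> (\<exists>h. (\<forall>p. h p \<ge> 0) \<and>
     (\<forall>p A. finite A \<and> 1 \<le> card A \<and> card A \<le> p \<longrightarrow> approximated n A (h p)))"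
  unfolding coarse_median_rank_le_def approximated_def ..

text \<open>In an approximating algebra, the element \<open>s\<close> of \<open>rank_le_imp_below_join\<close> is a join of boundedly many
  elements whose images are close to \<open>p\<close>, so its image is close to \<open>p\<close>; hence so is the image of the
  projection that lies between \<open>p\<close> and \<open>s\<close>.\<close>

lemma rank_le_imp_thin:
  assumes "coarse_median_rank_le \<mu> n"
  shows "\<exists>C. thin n R C"
proof -
  obtain h where "\<forall>p. h p \<ge> 0" and
    h: "\<And>p A. finite A \<Longrightarrow> 1 \<le> card A \<Longrightarrow> card A \<le> p \<Longrightarrow> approximated n A (h p)"
    using assms unfolding coarse_median_rank_le_iff by blast
  obtain L where L: "L \<ge> 0"
    "\<And>a b c a' b' c'. dist (\<mu> a b c) (\<mu> a' b' c') \<le> L * (dist a a' + dist b b' + dist c c') + L"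
    using coarse_lipschitz by blast
  have lip: "dist (\<mu> a b c) (\<mu> a' b' c') \<le> L * (r + s + t) + L"
    if "dist a a' \<le> r" "dist b b' \<le> s" "dist c c' \<le> t" for a b c a' b' c' r s t
    using L(2)[of a b c a' b' c'] mult_left_mono[OF add_mono[OF add_mono[OF that(1,2)] that(3)] L(1)]
    by linarith
  have chain: "dist a b \<le> r \<Longrightarrow> dist b c \<le> s \<Longrightarrow> dist a c \<le> r + s" for a b c :: 'a and r s
    by (meson add_mono dist_triangle order_trans)
  obtain ps where ps: "set ps = distinct_pairs n" using finite_list[OF finite_distinct_pairs] by blast
  \<comment> \<open>\<open>E\<^sub>1\<close>, \<open>E\<^sub>0\<close> and \<open>J k\<close> bound the distance from \<open>l p\<close> to the images of the median of \<open>x i\<close>, \<open>x j\<close>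
     and \<open>p\<close>, of its projection, and of a join of \<open>k\<close> such projections.\<close>
  define H where "H = h (n+3)"
  define E\<^sub>1 where "E\<^sub>1 = H + (L * (H + H + H) + L) + R + H"
  define E\<^sub>0 where "E\<^sub>0 = H + (L * (E\<^sub>1 + 0 + 0) + L)"
  define J where "J = (\<lambda>k. ((\<lambda>t. H + (L * (0 + E\<^sub>0 + t) + L)) ^^ k) 0)"
  define C where "C = H + ((L * (0 + 0 + J (length ps)) + L) + H) + H + (L * (H + H + H) + L)"
  have "thin n R C"
    unfolding thin_def
  proof (intro allI impI)
    fix x p q assume R: "\<forall>(i, j)\<in>distinct_pairs n. dist p (\<mu> (x i) (x j) p) \<le> R"
    define A where "A = insert p (insert q (x ` {1..n+1}))"
    have "card (x ` {1..n+1}) \<le> n + 1" using card_image_le[of "{1..n+1}" x] by simp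
    then have "card A \<le> n + 3" by (simp add: A_def card_insert_if)
    moreover have "1 \<le> card A" by (simp add: A_def card_gt_0_iff Suc_le_eq)
    ultimately have "approximated n A H" unfolding H_def by (intro h) (auto simp: A_def)
    then obtain P :: "nat set" and \<nu> \<pi> l where P: "median_algebra P \<nu>" "median_rank P \<nu> \<le> enat n"
      "\<pi> ` A \<subseteq> P" and
      "\<forall>x\<in>P. \<forall>y\<in>P. \<forall>z\<in>P. dist (l (\<nu> x y z)) (\<mu> (l x) (l y) (l z)) \<le> H" and
      "\<forall>a\<in>A. dist a (l (\<pi> a)) \<le> H"
      unfolding approximated_def by (elim exE conjE)
    then have l: "x \<in> P \<Longrightarrow> y \<in> P \<Longrightarrow> z \<in> P \<Longrightarrow> dist (l (\<nu> x y z)) (\<mu> (l x) (l y) (l z)) \<le> H"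
      and \<pi>: "a \<in> A \<Longrightarrow> dist a (l (\<pi> a)) \<le> H" for x y z a
      by simp_all
    interpret P: associative_median P \<nu> using associative_median_of_median_algebra[OF P(1)] .
    define p' q' x' where "p' = \<pi> p" and "q' = \<pi> q" and "x' = (\<lambda>i. \<pi> (x i))"
    have inP: "p' \<in> P" "q' \<in> P" "\<And>i. i \<in> {1..n+1} \<Longrightarrow> x' i \<in> P"
      using P(3) by (auto simp: A_def p'_def q'_def x'_def)
    have near: "dist p (l p') \<le> H" "dist q (l q') \<le> H" "\<And>i. i \<in> {1..n+1} \<Longrightarrow> dist (x i) (l (x' i)) \<le> H"
      using \<pi> by (auto simp: A_def p'_def q'_def x'_def)
    define w where "w = (\<lambda>(i, j). \<nu> (\<nu> (x' i) (x' j) p') p' q')"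
    have w: "w ij \<in> P \<and> dist (l (w ij)) (l p') \<le> E\<^sub>0" if "ij \<in> distinct_pairs n" for ij
    proof -
      obtain i j where "ij = (i, j)" by (cases ij)
      then have ij: "ij = (i, j)" "i \<in> {1..n+1}" "j \<in> {1..n+1}"
        using that by (auto simp: distinct_pairs_def)
      define u where "u = \<nu> (x' i) (x' j) p'"
      have u: "u \<in> P" using inP ij by (simp add: u_def P.closed)
      have "dist (l u) (\<mu> (l (x' i)) (l (x' j)) (l p')) \<le> H"
        unfolding u_def using inP ij by (intro l) auto
      moreover have "dist (\<mu> (l (x' i)) (l (x' j)) (l p')) (\<mu> (x i) (x j) p) \<le> L * (H + H + H) + L"
        using near ij by (intro lip) (auto simp: dist_commute)
      moreover have "dist (\<mu> (x i) (x j) p) p \<le> R" using R that ij by (auto simp: dist_commute)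
      ultimately have "dist (l u) (l p') \<le> E\<^sub>1"
        unfolding E\<^sub>1_def using near(1) by (blast intro: chain)
      then have "dist (\<mu> (l u) (l p') (l q')) (\<mu> (l p') (l p') (l q')) \<le> L * (E\<^sub>1 + 0 + 0) + L"
        by (intro lip) auto
      moreover have "dist (l (\<nu> u p' q')) (\<mu> (l u) (l p') (l q')) \<le> H" using u inP by (intro l)
      ultimately have "dist (l (\<nu> u p' q')) (l p') \<le> E\<^sub>0"
        unfolding E\<^sub>0_def idem by (blast intro: chain)
      then show ?thesis using u inP P.closed by (simp add: ij w_def u_def)
    qed
    have join: "dist (l (P.join q' (map w xs) p')) (l p') \<le> J (length xs)"
      if "set xs \<subseteq> distinct_pairs n" for xs
      using that
    proof (induction xs)
      case Nil
      then show ?case by (simp add: P.join_def J_def)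
    next
      case (Cons ij xs)
      define t where "t = P.join q' (map w xs) p'"
      have t: "t \<in> P" unfolding t_def using Cons.prems w inP by (intro P.join_closed) auto
      have "dist (l t) (l p') \<le> J (length xs)" using Cons by (simp add: t_def)
      then have "dist (\<mu> (l q') (l (w ij)) (l t)) (\<mu> (l q') (l p') (l p')) \<le>
          L * (0 + E\<^sub>0 + J (length xs)) + L"
        using w[of ij] Cons.prems by (intro lip) auto
      moreover have "dist (l (\<nu> q' (w ij) t)) (\<mu> (l q') (l (w ij)) (l t)) \<le> H"
        using t w[of ij] Cons.prems inP by (intro l) auto
      ultimately have "dist (l (\<nu> q' (w ij) t)) (l p') \<le> H + (L * (0 + E\<^sub>0 + J (length xs)) + L)"
        unfolding idem by (blast intro: chain)
      then show ?case by (simp add: P.join_def t_def J_def)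
    qed
    define s where "s = P.join q' (map w ps) p'"
    have s: "s \<in> P" unfolding s_def using w inP ps by (intro P.join_closed) auto
    obtain i where i: "i \<in> {1..n+1}" "\<nu> p' (\<nu> (x' i) p' q') s = \<nu> (x' i) p' q'"
      using P.rank_le_imp_below_join[OF P(2) inP(3) inP(1,2) ps s_def[unfolded w_def]] by blast
    define y where "y = \<nu> (x' i) p' q'"
    have y: "y \<in> P" using inP i by (simp add: y_def P.closed)
    have "dist (\<mu> (l p') (l y) (l p')) (\<mu> (l p') (l y) (l s)) \<le> L * (0 + 0 + J (length ps)) + L"
      using join[of ps] ps by (intro lip) (auto simp: s_def dist_commute)
    moreover have "dist (\<mu> (l p') (l y) (l s)) (l y) \<le> H"
      using l[of p' y s] inP s y i(2) by (simp add: y_def dist_commute)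
    ultimately have "dist (l p') (l y) \<le> (L * (0 + 0 + J (length ps)) + L) + H"
      unfolding idem by (blast intro: chain)
    moreover have "dist (l y) (\<mu> (l (x' i)) (l p') (l q')) \<le> H"
      unfolding y_def using inP i by (intro l) auto
    moreover have "dist (\<mu> (l (x' i)) (l p') (l q')) (\<mu> (x i) p q) \<le> L * (H + H + H) + L"
      using near i by (intro lip) (auto simp: dist_commute)
    ultimately have "dist p (\<mu> (x i) p q) \<le> C"
      unfolding C_def using near(1) by (blast intro: chain)
    then show "\<exists>i\<in>{1..n+1}. dist p (\<mu> (x i) p q) \<le> C" using i(1) by blast
  qed
  then show ?thesis ..
qed

lemma approximated_mono:
  assumes "approximated n A h" and h: "h \<le> h'"
  shows "approximated n A h'"
proof -
  obtain P :: "nat set" and \<nu> \<pi> l where P: "finite P" "median_algebra P \<nu>" "median_rank P \<nu> \<le> enat n"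
      "\<pi> ` A \<subseteq> P" and
      l: "\<forall>x\<in>P. \<forall>y\<in>P. \<forall>z\<in>P. dist (l (\<nu> x y z)) (\<mu> (l x) (l y) (l z)) \<le> h" and
      \<pi>: "\<forall>a\<in>A. dist a (l (\<pi> a)) \<le> h"
    using assms(1) unfolding approximated_def by (elim exE conjE)
  have "\<forall>x\<in>P. \<forall>y\<in>P. \<forall>z\<in>P. dist (l (\<nu> x y z)) (\<mu> (l x) (l y) (l z)) \<le> h'"
    "\<forall>a\<in>A. dist a (l (\<pi> a)) \<le> h'"
    using l \<pi> order_trans[OF _ h] by simp_all
  then show ?thesis unfolding approximated_def using P
    by (intro exI[of _ P] exI[of _ \<nu>] exI[of _ \<pi>] exI[of _ l] conjI)
qed

section \<open>Thin cubes imply bounded rank\<close>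

text \<open>Points that depend on a tuple \<open>a\<close> by a median expression in its first \<open>p\<close> entries.\<close>

inductive_set expressions :: "nat \<Rightarrow> ((nat \<Rightarrow> 'a) \<Rightarrow> 'a) set" for p where
  entry: "i < p \<Longrightarrow> (\<lambda>a. a i) \<in> expressions p"
| median: "s \<in> expressions p \<Longrightarrow> t \<in> expressions p \<Longrightarrow> u \<in> expressions p \<Longrightarrow>
    (\<lambda>a. \<mu> (s a) (t a) (u a)) \<in> expressions p"

definition close_on :: "(nat \<Rightarrow> 'a) set \<Rightarrow> ((nat \<Rightarrow> 'a) \<Rightarrow> 'a) \<Rightarrow> ((nat \<Rightarrow> 'a) \<Rightarrow> 'a) \<Rightarrow> bool" where
  "close_on K s t \<longleftrightarrow> (\<exists>C. \<forall>a\<in>K. dist (s a) (t a) \<le> C)"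

lemma close_on_refl: "close_on K s s"
  unfolding close_on_def by (intro exI[of _ 0]) simp

lemma close_on_sym: "close_on K s t \<Longrightarrow> close_on K t s"
  by (simp add: close_on_def dist_commute)

lemma close_on_trans:
  assumes "close_on K s t" "close_on K t u"
  shows "close_on K s u"
proof -
  obtain C D where "\<forall>a\<in>K. dist (s a) (t a) \<le> C" "\<forall>a\<in>K. dist (t a) (u a) \<le> D"
    using assms unfolding close_on_def by blast
  then have "\<forall>a\<in>K. dist (s a) (u a) \<le> C + D" by (meson add_mono dist_triangle order_trans)
  then show ?thesis unfolding close_on_def ..
qed

lemma close_on_subset: "close_on K s t \<Longrightarrow> K' \<subseteq> K \<Longrightarrow> close_on K' s t"
  unfolding close_on_def by (elim exE, rule exI) (rule ballI, erule bspec, erule subsetD)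

lemma close_on_median:
  assumes "close_on K s s'" "close_on K t t'" "close_on K u u'"
  shows "close_on K (\<lambda>a. \<mu> (s a) (t a) (u a)) (\<lambda>a. \<mu> (s' a) (t' a) (u' a))"
proof -
  obtain L where L: "L \<ge> 0"
    "\<And>a b c a' b' c'. dist (\<mu> a b c) (\<mu> a' b' c') \<le> L * (dist a a' + dist b b' + dist c c') + L"
    using coarse_lipschitz by blast
  obtain C D E where C: "\<And>a. a \<in> K \<Longrightarrow> dist (s a) (s' a) \<le> C" "\<And>a. a \<in> K \<Longrightarrow> dist (t a) (t' a) \<le> D"
    "\<And>a. a \<in> K \<Longrightarrow> dist (u a) (u' a) \<le> E"
    using assms unfolding close_on_def by blast
  have "dist (\<mu> (s a) (t a) (u a)) (\<mu> (s' a) (t' a) (u' a)) \<le> L * (C + D + E) + L" if "a \<in> K" for a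
    using L(2)[of "s a" "t a" "u a" "s' a" "t' a" "u' a"]
      mult_left_mono[OF add_mono[OF add_mono[OF C(1,2)[OF that]] C(3)[OF that]] L(1)] by linarith
  then show ?thesis unfolding close_on_def by blast
qed

lemma close_on_four_point:
  "close_on K (\<lambda>a. \<mu> (\<mu> (s a) (t a) (u a)) (t a) (v a)) (\<lambda>a. \<mu> (s a) (t a) (\<mu> (u a) (t a) (v a)))"
proof -
  obtain \<kappa> where "\<And>a b c d. dist (\<mu> (\<mu> a b c) b d) (\<mu> a b (\<mu> c b d)) \<le> \<kappa>" using C2 by blast
  then show ?thesis unfolding close_on_def by (intro exI[of _ \<kappa>]) simp
qed

text \<open>The asymptotic algebra on \<open>K\<close>: expressions up to bounded distance on \<open>K\<close>, each class being
  given by a chosen representative.\<close>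

definition rep :: "nat \<Rightarrow> (nat \<Rightarrow> 'a) set \<Rightarrow> ((nat \<Rightarrow> 'a) \<Rightarrow> 'a) \<Rightarrow> ((nat \<Rightarrow> 'a) \<Rightarrow> 'a)" where
  "rep p K s = (SOME t. t \<in> expressions p \<and> close_on K s t)"

definition asymptotic :: "nat \<Rightarrow> (nat \<Rightarrow> 'a) set \<Rightarrow> ((nat \<Rightarrow> 'a) \<Rightarrow> 'a) set" where
  "asymptotic p K = rep p K ` expressions p"

definition asymptotic_median :: "nat \<Rightarrow> (nat \<Rightarrow> 'a) set \<Rightarrow> ((nat \<Rightarrow> 'a) \<Rightarrow> 'a) ternary" where
  "asymptotic_median p K s t u = rep p K (\<lambda>a. \<mu> (s a) (t a) (u a))"

lemma rep:
  assumes "s \<in> expressions p"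
  shows "rep p K s \<in> expressions p" "close_on K s (rep p K s)"
proof -
  have "\<exists>t. t \<in> expressions p \<and> close_on K s t" using assms close_on_refl by blast
  then have "rep p K s \<in> expressions p \<and> close_on K s (rep p K s)"
    unfolding rep_def by (rule someI_ex)
  then show "rep p K s \<in> expressions p" "close_on K s (rep p K s)" by simp_all
qed

lemma rep_eqI:
  assumes "close_on K s t"
  shows "rep p K s = rep p K t"
proof -
  have "close_on K s u \<longleftrightarrow> close_on K t u" for u
    using assms close_on_sym close_on_trans by blast
  then show ?thesis unfolding rep_def by simp
qed

lemma rep_asymptotic:
  assumes "s \<in> asymptotic p K"
  shows "rep p K s = s"
proof -
  obtain t where "t \<in> expressions p" "s = rep p K t"
    using assms by (auto simp: asymptotic_def)
  then show ?thesis using rep_eqI[OF close_on_sym[OF rep(2)]] by simp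
qed

lemma asymptotic_expressions: "s \<in> asymptotic p K \<Longrightarrow> s \<in> expressions p"
  using rep(1) by (auto simp: asymptotic_def)

lemma asymptotic_eqI:
  assumes "s \<in> asymptotic p K" "t \<in> asymptotic p K" "close_on K s t"
  shows "s = t"
proof -
  have "s = rep p K s" by (rule rep_asymptotic[OF assms(1), symmetric])
  also have "\<dots> = rep p K t" by (rule rep_eqI[OF assms(3)])
  also have "\<dots> = t" by (rule rep_asymptotic[OF assms(2)])
  finally show ?thesis .
qed

lemma close_on_asymptotic_median:
  assumes "s \<in> asymptotic p K" "t \<in> asymptotic p K" "u \<in> asymptotic p K"
  shows "close_on K (asymptotic_median p K s t u) (\<lambda>a. \<mu> (s a) (t a) (u a))"
  unfolding asymptotic_median_def
  by (rule close_on_sym[OF rep(2)[OF median[OF assms[THEN asymptotic_expressions]]]])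

lemma asymptotic_median_closed:
  assumes "s \<in> asymptotic p K" "t \<in> asymptotic p K" "u \<in> asymptotic p K"
  shows "asymptotic_median p K s t u \<in> asymptotic p K"
proof -
  have "(\<lambda>a. \<mu> (s a) (t a) (u a)) \<in> expressions p"
    by (rule median[OF assms[THEN asymptotic_expressions]])
  then show ?thesis unfolding asymptotic_median_def asymptotic_def by (rule imageI)
qed

lemma associative_median_asymptotic:
  "associative_median (asymptotic p K) (asymptotic_median p K)"
proof
  fix s t u assume "s \<in> asymptotic p K" "t \<in> asymptotic p K" "u \<in> asymptotic p K"
  then show "asymptotic_median p K s t u \<in> asymptotic p K" by (rule asymptotic_median_closed)
next
  fix s t assume "s \<in> asymptotic p K"
  then show "asymptotic_median p K s s t = s" by (simp add: asymptotic_median_def M1 rep_asymptotic)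
next
  show "fully_symmetric_on (asymptotic p K) (asymptotic_median p K)"
    unfolding fully_symmetric_on_def asymptotic_median_def using perm by simp
next
  fix s t u v
  assume A: "s \<in> asymptotic p K" "t \<in> asymptotic p K" "u \<in> asymptotic p K" "v \<in> asymptotic p K"
  let ?m = "asymptotic_median p K"
  note cl = asymptotic_median_closed
  have "close_on K (?m (?m s t u) t v) (\<lambda>a. \<mu> (?m s t u a) (t a) (v a))"
    using A by (intro close_on_asymptotic_median cl)
  moreover have "close_on K (\<lambda>a. \<mu> (?m s t u a) (t a) (v a)) (\<lambda>a. \<mu> (\<mu> (s a) (t a) (u a)) (t a) (v a))"
    using A by (intro close_on_median close_on_refl close_on_asymptotic_median)
  moreover note close_on_four_point[of K s t u v]
  moreover have "close_on K (\<lambda>a. \<mu> (s a) (t a) (\<mu> (u a) (t a) (v a))) (\<lambda>a. \<mu> (s a) (t a) (?m u t v a))"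
    using A by (intro close_on_median close_on_refl close_on_sym[OF close_on_asymptotic_median])
  moreover have "close_on K (\<lambda>a. \<mu> (s a) (t a) (?m u t v a)) (?m s t (?m u t v))"
    using A by (intro close_on_sym[OF close_on_asymptotic_median] cl)
  ultimately have "close_on K (?m (?m s t u) t v) (?m s t (?m u t v))"
    using close_on_trans by blast
  moreover have "?m (?m s t u) t v \<in> asymptotic p K" "?m s t (?m u t v) \<in> asymptotic p K"
    using A by (simp_all add: cl)
  ultimately show "?m (?m s t u) t v = ?m s t (?m u t v)"
    using asymptotic_eqI by blast
qed

lemma finite_asymptotic: "finite (asymptotic p K)"
proof -
  interpret Q: associative_median "asymptotic p K" "asymptotic_median p K"
    by (rule associative_median_asymptotic)
  let ?G = "(\<lambda>i. rep p K (\<lambda>a. a i)) ` {..<p}"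
  show ?thesis
  proof (rule Q.finitely_generated_finite[of ?G])
    show "?G \<subseteq> asymptotic p K" using entry by (auto simp: asymptotic_def)
    fix S assume S: "?G \<subseteq> S" "median_subalgebra S (asymptotic p K) (asymptotic_median p K)"
    have "rep p K s \<in> S" if "s \<in> expressions p" for s
      using that
    proof (induction rule: expressions.induct)
      case (entry i)
      then show ?case using S(1) by auto
    next
      case (median s t u)
      have "rep p K (\<lambda>a. \<mu> (s a) (t a) (u a)) = asymptotic_median p K (rep p K s) (rep p K t) (rep p K u)"
        unfolding asymptotic_median_def using median.hyps by (intro rep_eqI close_on_median rep)
      then show ?case using S(2) median.IH by (simp add: median_subalgebra_def)
    qed
    then show "S = asymptotic p K"
      using S(2) by (auto simp: asymptotic_def median_subalgebra_def)
  qed simp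
qed

text \<open>If the asymptotic algebra on \<open>K\<close> has rank at most \<open>n\<close>, its elements, evaluated at \<open>a\<close>,
  approximate the tuple \<open>a\<close>, with an error that does not depend on \<open>a \<in> K\<close>.\<close>

lemma approximated_if_rank_le:
  assumes rank: "median_rank (asymptotic p K) (asymptotic_median p K) \<le> enat n"
  shows "\<exists>h. \<forall>a\<in>K. approximated n (a ` {..<p}) h"
proof -
  let ?Q = "asymptotic p K" and ?m = "asymptotic_median p K"
  interpret Q: associative_median ?Q ?m by (rule associative_median_asymptotic)
  obtain e :: "((nat \<Rightarrow> 'a) \<Rightarrow> 'a) \<Rightarrow> nat" where e: "inj_on e ?Q"
    using finite_imp_inj_to_nat_seg[OF finite_asymptotic] by blast
  define d where "d = inv_into ?Q e"
  have d: "d (e s) = s" if "s \<in> ?Q" for s using that e by (simp add: d_def)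
  define \<nu> where "\<nu> = (\<lambda>x y z. e (?m (d x) (d y) (d z)))"
  have \<nu>: "\<nu> (e s) (e t) (e u) = e (?m s t u)" if "s \<in> ?Q" "t \<in> ?Q" "u \<in> ?Q" for s t u
    using that by (simp add: \<nu>_def d)
  have alg: "median_algebra (e ` ?Q) \<nu>"
  proof
    show "fully_symmetric_on (e ` ?Q) \<nu>"
      using Q.M2 by (auto simp: fully_symmetric_on_def \<nu>)
  qed (auto simp: \<nu> Q.closed Q.idem intro!: arg_cong[of _ _ e] Q.M3)
  have rank': "median_rank (e ` ?Q) \<nu> \<le> enat n"
  proof (rule order_trans[OF _ rank])
    show "median_rank (e ` ?Q) \<nu> \<le> median_rank ?Q ?m"
      by (rule rank_le_transport[of e ?Q ?m \<nu>]) (simp_all add: e Q.closed \<nu>)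
  qed
  have "\<exists>C. \<forall>a\<in>K. dist (?m s t u a) (\<mu> (s a) (t a) (u a)) \<le> C"
    if "(s, t, u) \<in> ?Q \<times> ?Q \<times> ?Q" for s t u
    using that close_on_asymptotic_median[of s p K t u] unfolding close_on_def by simp
  then obtain C where C: "\<And>s t u a. (s, t, u) \<in> ?Q \<times> ?Q \<times> ?Q \<Longrightarrow> a \<in> K \<Longrightarrow>
      dist (?m s t u a) (\<mu> (s a) (t a) (u a)) \<le> C s t u"
    by metis
  have "\<exists>D. \<forall>a\<in>K. dist (a i) (rep p K (\<lambda>a. a i) a) \<le> D" if "i < p" for i
    using rep(2)[OF entry[OF that]] unfolding close_on_def .
  then obtain D where D: "\<And>i a. i < p \<Longrightarrow> a \<in> K \<Longrightarrow> dist (a i) (rep p K (\<lambda>a. a i) a) \<le> D i"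
    by metis
  define h where "h = (\<Sum>(s, t, u)\<in>?Q \<times> ?Q \<times> ?Q. \<bar>C s t u\<bar>) + (\<Sum>i<p. \<bar>D i\<bar>)"
  have Ch: "C s t u \<le> h" if "(s, t, u) \<in> ?Q \<times> ?Q \<times> ?Q" for s t u
  proof -
    have "\<bar>C s t u\<bar> \<le> (\<Sum>(s, t, u)\<in>?Q \<times> ?Q \<times> ?Q. \<bar>C s t u\<bar>)"
      using member_le_sum[OF that, of "\<lambda>(s, t, u). \<bar>C s t u\<bar>"] finite_asymptotic by auto
    moreover have "0 \<le> (\<Sum>i<p. \<bar>D i\<bar>)" by (intro sum_nonneg) auto
    ultimately show ?thesis unfolding h_def by linarith
  qed
  have Dh: "D i \<le> h" if "i < p" for i
  proof -
    have "\<bar>D i\<bar> \<le> (\<Sum>i<p. \<bar>D i\<bar>)" using that by (intro member_le_sum) auto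
    moreover have "0 \<le> (\<Sum>(s, t, u)\<in>?Q \<times> ?Q \<times> ?Q. \<bar>C s t u\<bar>)" by (intro sum_nonneg) auto
    ultimately show ?thesis unfolding h_def by linarith
  qed
  have "approximated n (a ` {..<p}) h" if a: "a \<in> K" for a
  proof -
    define \<pi> where "\<pi> = (\<lambda>x. e (rep p K (\<lambda>b. b (inv_into {..<p} a x))))"
    define l where "l = (\<lambda>k. d k a)"
    have repQ: "rep p K (\<lambda>a. a i) \<in> ?Q" if "i < p" for i
      using that entry by (auto simp: asymptotic_def)
    have inv: "inv_into {..<p} a x < p" "a (inv_into {..<p} a x) = x" if "x \<in> a ` {..<p}" for x
      using that inv_into_into[of x a "{..<p}"] f_inv_into_f[of x a "{..<p}"] by auto
    have "dist (l (\<nu> x y z)) (\<mu> (l x) (l y) (l z)) \<le> h" if xyz: "x \<in> e ` ?Q" "y \<in> e ` ?Q" "z \<in> e ` ?Q" for x y z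
    proof -
      obtain s t u where s: "s \<in> ?Q" "t \<in> ?Q" "u \<in> ?Q" "x = e s" "y = e t" "z = e u"
        using xyz by blast
      then have "dist (l (\<nu> x y z)) (\<mu> (l x) (l y) (l z)) \<le> C s t u"
        using C[of s t u a] a by (simp add: l_def \<nu> d Q.closed)
      also have "\<dots> \<le> h" using s by (intro Ch) auto
      finally show ?thesis .
    qed
    moreover have "dist x (l (\<pi> x)) \<le> h" if "x \<in> a ` {..<p}" for x
      using D[OF inv(1)[OF that] a] Dh[OF inv(1)[OF that]] repQ[OF inv(1)[OF that]] inv(2)[OF that]
      by (simp add: l_def \<pi>_def d)
    moreover have "\<pi> ` a ` {..<p} \<subseteq> e ` ?Q" using inv(1) repQ by (auto simp: \<pi>_def)
    ultimately show ?thesis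
      unfolding approximated_def using alg rank' finite_asymptotic
      by (intro exI[of _ "e ` ?Q"] exI[of _ \<nu>] exI[of _ \<pi>] exI[of _ l] conjI) simp_all
  qed
  then show ?thesis by blast
qed

text \<open>If the rank is larger, the corner of a cube in the asymptotic algebra gives, by thinness, for each
  \<open>a \<in> K\<close> an index \<open>i\<close> for which \<open>c a\<close> and \<open>x i a\<close> are close.  The parts of \<open>K\<close> on which
  \<open>i\<close> is constant are finitely many and have smaller asymptotic algebras.\<close>

lemma thin_imp_approximated:
  fixes p :: nat
  assumes thin: "\<And>R. \<exists>C. thin n R C"
  shows "\<exists>h. \<forall>a\<in>K. approximated n (a ` {..<p}) h"
proof (induction "card (asymptotic p K)" arbitrary: K rule: less_induct)
  case less
  let ?Q = "asymptotic p K" and ?m = "asymptotic_median p K"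
  show ?case
  proof (cases "median_rank ?Q ?m \<le> enat n")
    case True
    then show ?thesis by (rule approximated_if_rank_le)
  next
    case False
    then obtain x c q where c: "c \<in> ?Q" and q: "q \<in> ?Q"
      and x: "\<And>i. i \<in> {1..n+1} \<Longrightarrow> x i \<in> ?Q \<and> x i \<noteq> c \<and> ?m (x i) c q = x i"
      and xx: "\<And>i j. (i, j) \<in> distinct_pairs n \<Longrightarrow> ?m (x i) (x j) c = c"
      using rank_gt_imp_corner by metis
    have "\<exists>R. \<forall>a\<in>K. dist (c a) (\<mu> (x i a) (x j a) (c a)) \<le> R" if ij: "(i, j) \<in> distinct_pairs n" for i j
    proof -
      have "x i \<in> ?Q" "x j \<in> ?Q" using x ij by (auto simp: distinct_pairs_def)
      then show ?thesis
        using close_on_asymptotic_median[of "x i" p K "x j" c] c xx[OF ij] unfolding close_on_def by simp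
    qed
    then obtain R where R: "\<And>i j a. (i, j) \<in> distinct_pairs n \<Longrightarrow> a \<in> K \<Longrightarrow>
        dist (c a) (\<mu> (x i a) (x j a) (c a)) \<le> R i j"
      by metis
    have "\<exists>B. \<forall>a\<in>K. dist (\<mu> (x i a) (c a) (q a)) (x i a) \<le> B" if i: "i \<in> {1..n+1}" for i
      using close_on_sym[OF close_on_asymptotic_median[of "x i" p K c q]] c q x[OF i]
      unfolding close_on_def by simp
    then obtain B where B: "\<And>i a. i \<in> {1..n+1} \<Longrightarrow> a \<in> K \<Longrightarrow>
        dist (\<mu> (x i a) (c a) (q a)) (x i a) \<le> B i"
      by metis
    obtain C where C: "thin n (\<Sum>(i, j)\<in>distinct_pairs n. \<bar>R i j\<bar>) C" using thin by blast
    define K' where "K' = (\<lambda>i. {a \<in> K. dist (c a) (x i a) \<le> C + B i})"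
    have cover: "\<exists>i\<in>{1..n+1}. a \<in> K' i" if a: "a \<in> K" for a
    proof -
      have "dist (c a) (\<mu> (x i a) (x j a) (c a)) \<le> (\<Sum>(i, j)\<in>distinct_pairs n. \<bar>R i j\<bar>)"
        if "(i, j) \<in> distinct_pairs n" for i j
      proof -
        have "\<bar>R i j\<bar> \<le> (\<Sum>(i, j)\<in>distinct_pairs n. \<bar>R i j\<bar>)"
          using member_le_sum[OF that, of "\<lambda>(i, j). \<bar>R i j\<bar>"] finite_distinct_pairs by auto
        then show ?thesis using R[OF that a] by linarith
      qed
      then obtain i where i: "i \<in> {1..n+1}" "dist (c a) (\<mu> (x i a) (c a) (q a)) \<le> C"
        using C[unfolded thin_def, rule_format, of "c a" "\<lambda>i. x i a" "q a"] by blast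
      have "dist (c a) (x i a) \<le> C + B i" using i(2) B[OF i(1) a] by metric
      then show ?thesis using i(1) a by (auto simp: K'_def)
    qed
    have "\<exists>h. \<forall>a\<in>K' i. approximated n (a ` {..<p}) h" if i: "i \<in> {1..n+1}" for i
    proof (rule less)
      have sub: "K' i \<subseteq> K" by (auto simp: K'_def)
      have "asymptotic p (K' i) = rep p (K' i) ` ?Q"
      proof -
        have "rep p (K' i) s = rep p (K' i) (rep p K s)" if "s \<in> expressions p" for s
          using rep_eqI[OF close_on_subset[OF rep(2)[OF that] sub]] .
        then show ?thesis unfolding asymptotic_def image_image by simp
      qed
      moreover have "card (rep p (K' i) ` ?Q) < card ?Q"
      proof -
        have "close_on (K' i) c (x i)" by (auto simp: close_on_def K'_def)
        then have "rep p (K' i) c = rep p (K' i) (x i)" by (rule rep_eqI)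
        then have "\<not> inj_on (rep p (K' i)) ?Q" using c x[OF i] by (metis inj_on_def)
        then have "card (rep p (K' i) ` ?Q) \<noteq> card ?Q"
          using finite_asymptotic eq_card_imp_inj_on by blast
        then show ?thesis using card_image_le[OF finite_asymptotic, of "rep p (K' i)" p K] by linarith
      qed
      ultimately show "card (asymptotic p (K' i)) < card ?Q" by simp
    qed
    then obtain h where h: "\<And>i a. i \<in> {1..n+1} \<Longrightarrow> a \<in> K' i \<Longrightarrow> approximated n (a ` {..<p}) (h i)"
      by metis
    have "approximated n (a ` {..<p}) (\<Sum>i\<in>{1..n+1}. \<bar>h i\<bar>)" if a: "a \<in> K" for a
    proof -
      obtain i where i: "i \<in> {1..n+1}" "a \<in> K' i" using cover[OF a] by blast
      have "\<bar>h i\<bar> \<le> (\<Sum>i\<in>{1..n+1}. \<bar>h i\<bar>)" using i(1) by (intro member_le_sum) auto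
      then have "h i \<le> (\<Sum>i\<in>{1..n+1}. \<bar>h i\<bar>)" by linarith
      then show ?thesis using approximated_mono h[OF i] by blast
    qed
    then show ?thesis by blast
  qed
qed

lemma thin_imp_rank_le:
  assumes "\<And>R. \<exists>C. thin n R C"
  shows "coarse_median_rank_le \<mu> n"
proof -
  have "\<exists>h. \<forall>a\<in>UNIV. approximated n (a ` {..<p}) h" for p :: nat
    by (rule thin_imp_approximated) (rule assms)
  then obtain h where h: "approximated n (a ` {..<p}) (h p)"
    for p :: nat and a :: "nat \<Rightarrow> 'a" by (metis UNIV_I)
  have "approximated n A \<bar>h p\<bar>" if A: "finite A" "1 \<le> card A" "card A \<le> p" for p A
  proof -
    have "\<exists>a. a ` {..<p} = A" 
    proof -
      obtain f where "bij_betw f {0..<card A} A" using ex_bij_betw_nat_finite[OF A(1)] by blast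
      then have f: "f ` {0..<card A} = A" by (simp add: bij_betw_def)
      have "(\<lambda>i. f (if i < card A then i else 0)) ` {..<p} = A" (is "?a ` _ = A")
      proof
        show "?a ` {..<p} \<subseteq> A" using f A(2) by auto
        show "A \<subseteq> ?a ` {..<p}"
        proof
          fix x assume "x \<in> A"
          then have "x \<in> f ` {0..<card A}" using f by simp
          then obtain i where "i < card A" "x = f i" by auto
          then show "x \<in> ?a ` {..<p}" using A(3) by (intro image_eqI[of _ _ i]) auto
        qed
      qed
      then show ?thesis by blast
    qed
    then show ?thesis using h[of _ p] approximated_mono abs_ge_self by metis
  qed
  then show ?thesis unfolding coarse_median_rank_le_iff by (intro exI[of _ "\<lambda>p. \<bar>h p\<bar>"]) auto
qed

lemma coarse_median_rank_le_iff_thin: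
  "coarse_median_rank_le \<mu> n \<longleftrightarrow> (\<forall>R. \<exists>C. thin n R C)"
proof (rule iffI)
  assume thin: "\<forall>R. \<exists>C. thin n R C"
  show "coarse_median_rank_le \<mu> n"
  proof (rule thin_imp_rank_le)
    show "\<exists>C. thin n R C" for R using thin by (rule spec)
  qed
next
  assume rank: "coarse_median_rank_le \<mu> n"
  show "\<forall>R. \<exists>C. thin n R C"
    by (rule allI, rule rank_le_imp_thin, rule rank)
qed

end

theorem theorem4p1:
  fixes \<mu> :: "'a::metric_space ternary" and n :: nat
  assumes "coarse_median_space \<mu>" and "n \<noteq> 0"
  shows "(coarse_median_rank_le \<mu> n \<longleftrightarrow> multi_median_condition \<mu> n) \<and>
         (multi_median_condition \<mu> n \<longleftrightarrow> thin_cubes_condition \<mu> n)"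
  unfolding coarse_median_space.coarse_median_rank_le_iff_thin[OF assms(1)]
    coarse_median_space.multi_median_condition_iff[OF assms(1)]
    coarse_median_space.thin_cubes_condition_iff[OF assms]
  by (intro conjI refl)

end
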